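(* Let $k\ge2$ and $m\ge1$ be integers and let $\gamma$ be a smooth closed convex curve in $\mathbb R^2$ with support function $h$. If $m$ is odd, then $$ \begin{aligned} 0\le{}&-\sum_{r=0}^{m-1}(-1)^r\binom{m-1}{r}F[\gamma_{(r)}]+\frac1k\int_0^{\frac\pi k}w_k(\theta)\,w_k\left(\theta+\frac\pi k\right)d\theta\\ &-\sum_{\substack{1\le j\le m-1\\ 2\mid j}}\binom mj\sum_{r=0}^{m-1}(-1)^r\binom{m-1-j}{r}F\left[\gamma_{(r)},(T_k^2\gamma)_{(r)}\right]\\ &+\sum_{\substack{1\le j\le m-1\\ 2\nmid j}}\binom mj\sum_{r=0}^{m-1}(-1)^r\binom{m-1-j}{r}F\left[\gamma_{(r)},(T_k\gamma)_{(r)}\right]. \end{aligned} $$ If $m$ is even, then $$ \begin{aligned} 0\le{}&\sum_{r=0}^{m-1}(-1)^r\binom{m-1}{r}F[\gamma_{(r)}]+\frac1{2k}\int_0^{\frac{2\pi}k}w_k(\theta)^2\,d\theta\\ &+\sum_{\substack{1\le j\le m-1\\ 2\mid j}}\binom mj\sum_{r=0}^{m-1}(-1)^r\binom{m-1-j}{r}F\left[\gamma_{(r)},(T_k^2\gamma)_{(r)}\right]\\ &-\sum_{\substack{1\le j\le m-1\\ 2\nmid j}}\binom mj\sum_{r=0}^{m-1}(-1)^r\binom{m-1-j}{r}F\left[\gamma_{(r)},(T_k\gamma)_{(r)}\right]. \end{aligned} $$ In each case, equality holds if and only if $\gamma$ is a circle.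
   Context: Setting: $\gamma$ is a simple closed convex curve, smoothly and regularly parametrised by its outward normal angle $\theta\in\mathbb R/2\pi\mathbb Z$. With $\boldsymbol n=(\cos\theta,\sin\theta)$ and $\boldsymbol t=(-\sin\theta,\cos\theta)$ and $h$ the ($2\pi$-periodic, smooth) support function, $\gamma(\theta)=h(\theta)\boldsymbol n+\dot h(\theta)\boldsymbol t$, and the radius of curvature is $\rho=h+\ddot h$. Generalized width: $w_k(\theta)=\sum_{j=0}^{k-1}h\left(\theta+\frac{2j\pi}k\right)$. Operator $T_k$: for a real-valued $2\pi$-periodic function $h$, $T_k[h](\theta)=\frac1k\sum_{i=1}^kh\left(\theta+\frac{(2i-1)\pi}k\right)$. The curve $T_k\gamma$ (resp. $T_k^2\gamma$) is the convex curve whose support function is $T_k[h]$ (resp. $(T_k)^2[h]=T_k[T_k[h]]$). Loci of curvature centers: $\gamma_{(0)}=\gamma$; $\gamma_{(1)}(\theta)=\gamma(\theta)-\rho(\theta)\boldsymbol n=\dot h\,\boldsymbol t-\ddot h\,\boldsymbol n$, which has support function $\dot h$ with respect to the unit normal field $\boldsymbol t$; inductively $\gamma_{(j)}$ is the locus of curvature centers of $\gamma_{(j-1)}$, so that, with $J$ the anticlockwise rotation by $\frac\pi2$, $\gamma_{(j)}$ has support function $h^{(j)}$ with respect to the normal $J^j\boldsymbol n$, i.e. $\gamma_{(j)}=J^j\left(h^{(j)}\boldsymbol n+h^{(j+1)}\boldsymbol t\right)$. The same definition applies to $T_k\gamma$ and $T_k^2\gamma$ with $h$ replaced by their support functions.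 These curves need not be simple or convex. Algebraic area and mixed area: $F[\beta]=\frac12\int x\,dy-y\,dx$ along the parametrised curve $\beta$, so $F[\gamma_{(j)}]=\frac12\int_0^{2\pi}\left(h^{(j)}(\theta)^2-h^{(j+1)}(\theta)^2\right)d\theta$. For curves $\beta,\delta$ with support functions $g,f$, the algebraic mixed area is $F[\beta_{(r)},\delta_{(r)}]=\frac12\int_0^{2\pi}\left(g^{(r)}f^{(r)}-g^{(r+1)}f^{(r+1)}\right)d\theta$. Convention: $\binom ab=0$ when $b>a\ge0$. *)

theory Defs
  imports "HOL-Analysis.Analysis"
begin

definition nvec :: "real \<Rightarrow> real^2" where
  "nvec \<theta> = vector [cos \<theta>, sin \<theta>]"

definition tvec :: "real \<Rightarrow> real^2" where
  "tvec \<theta> = vector [- sin \<theta>, cos \<theta>]"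

definition rot90 :: "real^2 \<Rightarrow> real^2" where
  "rot90 v = vector [- (v $ 2), v $ 1]"

definition vderiv :: "(real \<Rightarrow> real^2) \<Rightarrow> real \<Rightarrow> real^2" where
  "vderiv \<gamma> = (\<lambda>\<theta>. vector_derivative \<gamma> (at \<theta>))"

definition smooth_curve :: "(real \<Rightarrow> real^2) \<Rightarrow> bool" where
  "smooth_curve \<gamma> \<longleftrightarrow> (\<forall>p \<theta>. (vderiv ^^ p) \<gamma> differentiable (at \<theta>))"

text \<open>
  A simple closed curve is convex if it is the boundary of its convex hull. The last conjunct
  says that \<^term>\<open>nvec \<theta>\<close> is the outward normal at \<^term>\<open>\<gamma> \<theta>\<close>; in particular, it is
  orthogonal to the (nonzero) tangent vector there.
\<close>

definition smooth_convex_curve :: "(real \<Rightarrow> real^2) \<Rightarrow> bool" where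
  "smooth_convex_curve \<gamma> \<longleftrightarrow>
     smooth_curve \<gamma> \<and>
     (\<forall>\<theta>. \<gamma> (\<theta> + 2 * pi) = \<gamma> \<theta>) \<and>
     inj_on \<gamma> {0..<2 * pi} \<and>
     (\<forall>\<theta>. vderiv \<gamma> \<theta> \<noteq> 0) \<and>
     range \<gamma> = frontier (convex hull (range \<gamma>)) \<and>
     (\<forall>\<theta>. \<forall>x \<in> convex hull (range \<gamma>). (x - \<gamma> \<theta>) \<bullet> nvec \<theta> \<le> 0)"

definition is_circle :: "(real \<Rightarrow> real^2) \<Rightarrow> bool" where
  "is_circle \<gamma> \<longleftrightarrow> (\<exists>c r. r > 0 \<and> range \<gamma> = sphere c r)"

definition support_fun :: "(real \<Rightarrow> real^2) \<Rightarrow> real \<Rightarrow> real" where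
  "support_fun \<gamma> \<theta> = (SUP x\<in>range \<gamma>. x \<bullet> nvec \<theta>)"

definition curve_of_support :: "(real \<Rightarrow> real) \<Rightarrow> real \<Rightarrow> real^2" where
  "curve_of_support h \<theta> = h \<theta> *\<^sub>R nvec \<theta> + deriv h \<theta> *\<^sub>R tvec \<theta>"

definition gen_width :: "nat \<Rightarrow> (real \<Rightarrow> real) \<Rightarrow> real \<Rightarrow> real" where
  "gen_width k h \<theta> = (\<Sum>j<k. h (\<theta> + 2 * real j * pi / real k))"

definition T_op :: "nat \<Rightarrow> (real \<Rightarrow> real) \<Rightarrow> real \<Rightarrow> real" where
  "T_op k h \<theta> = 1 / real k * (\<Sum>i=1..k. h (\<theta> + (2 * real i - 1) * pi / real k))"

text \<open>
  The \<^term>\<open>j\<close>-th locus has the unit normal field \<open>\<nu> = J\<^sup>j n\<close>, where \<open>J\<close> is \<^term>\<open>rot90\<close>. Its signed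
  radius of curvature is the factor \<open>\<rho>\<close> in \<open>\<gamma>\<^sub>j' = \<rho> J \<nu>\<close>, and its centre of curvature
  is \<open>\<gamma>\<^sub>j - \<rho> \<nu>\<close>. The factor is read off as an inner product, so that the definition also
  makes sense at the cusps of a locus.
\<close>

primrec curv_locus :: "nat \<Rightarrow> (real \<Rightarrow> real^2) \<Rightarrow> real \<Rightarrow> real^2" where
  "curv_locus 0 \<gamma> = \<gamma>"
| "curv_locus (Suc j) \<gamma> =
     (\<lambda>\<theta>. curv_locus j \<gamma> \<theta>
          - (vderiv (curv_locus j \<gamma>) \<theta> \<bullet> (rot90 ^^ Suc j) (nvec \<theta>)) *\<^sub>R (rot90 ^^ j) (nvec \<theta>))"

definition alg_area :: "(real \<Rightarrow> real^2) \<Rightarrow> real" where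
  "alg_area \<beta> =
     1 / 2 * integral {0..2 * pi}
       (\<lambda>\<theta>. \<beta> \<theta> $ 1 * vderiv \<beta> \<theta> $ 2 - \<beta> \<theta> $ 2 * vderiv \<beta> \<theta> $ 1)"

text \<open>
  \<open>mixed_area r \<beta> \<delta>\<close> is the algebraic mixed area of the \<open>r\<close>-th loci of the convex curves
  \<open>\<beta>\<close> and \<open>\<delta>\<close>, whose support functions with respect to the common normal field \<open>J\<^sup>r n\<close> are the
  \<open>r\<close>-th derivatives of the support functions of \<open>\<beta>\<close> and \<open>\<delta>\<close>.
\<close>

definition mixed_area :: "nat \<Rightarrow> (real \<Rightarrow> real^2) \<Rightarrow> (real \<Rightarrow> real^2) \<Rightarrow> real" where
  "mixed_area r \<beta> \<delta> =
     (let g = support_fun \<beta>; f = support_fun \<delta>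
      in 1 / 2 * integral {0..2 * pi}
           (\<lambda>\<theta>. (deriv ^^ r) g \<theta> * (deriv ^^ r) f \<theta>
                - (deriv ^^ Suc r) g \<theta> * (deriv ^^ Suc r) f \<theta>))"

end

theory Submission
  imports Defs
begin

text \<open>
  The right-hand side of the inequality is a disguised quadratic form. Write \<open>\<langle>f, g\<rangle>\<close> for the
  integral of \<open>f g\<close> over a period, \<open>R = 1 + (d/d\<theta>)\<^sup>2\<close>, so that \<open>R h\<close> is the radius of curvature of
  the curve with support function \<open>h\<close>, and \<open>T = T\<^sub>k\<close>. Integration by parts gives
  \<open>F[\<gamma>\<^sub>r] = (-1)\<^sup>r \<langle>h, R (d/d\<theta>)\<^sup>2\<^sup>r h\<rangle> / 2\<close>, and likewise for the mixed areas. The binomial sums over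
  \<open>r\<close> therefore collapse, by the binomial theorem for \<open>R = 1 + (d/d\<theta>)\<^sup>2\<close>, to \<open>\<langle>h, R\<^sup>m h\<rangle> / 2\<close>,
  \<open>\<langle>h, R\<^sup>m\<^sup>-\<^sup>j T h\<rangle> / 2\<close> and \<open>\<langle>h, R\<^sup>m\<^sup>-\<^sup>j T\<^sup>2 h\<rangle> / 2\<close> (\<open>sum_inner_dif_radius_op\<close>). The width integrals are
  \<open>\<langle>h, T h\<rangle> / 2\<close> and \<open>\<langle>h, T\<^sup>2 h\<rangle> / 2\<close>. Because \<open>T\<^sup>3 = T\<close>, every power \<open>T\<^sup>j\<close> with \<open>j \<ge> 1\<close> is \<open>T\<close> or
  \<open>T\<^sup>2\<close>, according to the parity of \<open>j\<close>. So the whole expression is \<open>(-1)\<^sup>m \<langle>h, A\<^sup>m h\<rangle> / 2\<close> with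
  \<open>A = R - T\<close> (\<open>gap_op_power_expansion\<close>).

  The operator \<open>A\<close> is self-adjoint and \<open>\<langle>f, A f\<rangle> \<le> 0\<close> (\<open>gap_op_nonpos\<close>). For this, let \<open>S = T\<^sup>2\<close>
  be the average over the rotations by multiples of \<open>2\<pi>/k\<close>, and split \<open>f\<close> into \<open>f - S f\<close>, the mean
  value, and \<open>v\<close>, the rest of \<open>S f\<close>. These parts are orthogonal. The constant contributes nothing,
  on \<open>f - S f\<close> the operator \<open>T\<close> vanishes and Wirtinger's inequality applies, and \<open>v\<close> has mean zero
  and period \<open>2\<pi>/k\<close>, so that Wirtinger's inequality gains a factor \<open>k\<^sup>2 \<ge> 4\<close>, which outweighs the
  term with \<open>T\<close>. Hence \<open>(-1)\<^sup>m \<langle>h, A\<^sup>m h\<rangle> \<ge> 0\<close>: halving the exponent leaves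
  \<open>\<langle>g, g\<rangle>\<close> or \<open>- \<langle>g, A g\<rangle>\<close> with \<open>g = A\<^sup>p h\<close>, \<open>p = m div 2\<close>.

  Self-adjointness also shows that equality forces \<open>A h = 0\<close>. The equality case of Wirtinger's
  inequality turns this into \<open>R h = const\<close> (\<open>gap_op_kernel\<close>): the radius of curvature is constant,
  and the curve is a circle.

  To use inner product algebra freely, the smooth \<open>2\<pi>\<close>-periodic functions are made into a type of
  class \<^class>\<open>real_inner\<close>, on which differentiation, rotation and averaging are total linear maps.
\<close>

section \<open>Integrals of periodic functions\<close>

text \<open>
  With a global antiderivative, statements on integrals over translated or repeated periods become
  statements on the increments of one function.
\<close>

lemma continuous_antiderivative:
  fixes f :: "real \<Rightarrow> real"
  assumes "continuous_on UNIV f"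
  obtains F where "\<And>x. (F has_real_derivative f x) (at x)"
    and "\<And>a b. a \<le> b \<Longrightarrow> integral {a..b} f = F b - F a"
proof -
  have "\<exists>F. \<forall>x::real. -\<infinity> < ereal x \<longrightarrow> ereal x < \<infinity> \<longrightarrow> (F has_vector_derivative f x) (at x)"
    using assms by (intro einterval_antiderivative) (auto simp: continuous_on_eq_continuous_at)
  then obtain F where F: "\<And>x. (F has_real_derivative f x) (at x)"
    by (auto simp: has_real_derivative_iff_has_vector_derivative)
  have "integral {a..b} f = F b - F a" if "a \<le> b" for a b
    using that F by (intro integral_unique fundamental_theorem_of_calculus)
      (auto simp: has_real_derivative_iff_has_vector_derivative intro: has_vector_derivative_at_within)
  with F that show thesis by blast
qed

lemma integral_over_period:
  fixes f :: "real \<Rightarrow> real"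
  assumes cont: "continuous_on UNIV f" and per: "\<And>x. f (x + L) = f x" and "0 \<le> L"
  shows "integral {a..a + L} f = integral {0..L} f"
    and "integral {0..L} (\<lambda>x. f (x + a)) = integral {0..L} f"
    and "integral {0..real n * L} f = real n * integral {0..L} f"
proof -
  obtain F where F: "\<And>x. (F has_real_derivative f x) (at x)"
    and int: "\<And>a b. a \<le> b \<Longrightarrow> integral {a..b} f = F b - F a"
    using continuous_antiderivative[OF cont] by blast
  \<comment> \<open>The increment of an antiderivative over one period does not depend on the starting point.\<close>
  have "((\<lambda>x. F (x + L) - F x) has_real_derivative 0) (at x)" for x
  proof -
    have "((\<lambda>x. F (x + L)) has_real_derivative f (x + L)) (at x)"
      using F[of "x + L"] by (simp add: DERIV_shift)
    from DERIV_diff[OF this F[of x]] show ?thesis using per by simp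
  qed
  then have step: "F (x + L) - F x = F L - F 0" for x
    using DERIV_isconst_all[of "\<lambda>x. F (x + L) - F x" x 0] by simp
  show 1: "integral {a..a + L} f = integral {0..L} f"
    using int[of a "a + L"] int[of 0 L] step[of a] \<open>0 \<le> L\<close> by simp
  have "((\<lambda>x. f (x + a)) has_integral (F (L + a) - F (0 + a))) {0..L}"
  proof (rule fundamental_theorem_of_calculus[OF \<open>0 \<le> L\<close>])
    fix x
    have "((\<lambda>x. F (x + a)) has_real_derivative f (x + a)) (at x)"
      using F[of "x + a"] by (simp add: DERIV_shift)
    then show "((\<lambda>x. F (x + a)) has_vector_derivative f (x + a)) (at x within {0..L})"
      by (auto simp: has_real_derivative_iff_has_vector_derivative
          intro: has_vector_derivative_at_within)
  qed
  then show "integral {0..L} (\<lambda>x. f (x + a)) = integral {0..L} f"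
    using 1 int[of a "a + L"] \<open>0 \<le> L\<close> by (simp add: integral_unique add.commute)
  have "F (real n * L) - F 0 = real n * (F L - F 0)"
  proof (induction n)
    case (Suc n)
    have "real (Suc n) * L = real n * L + L" by (simp add: algebra_simps)
    then have "F (real (Suc n) * L) - F 0 = (F (real n * L) - F 0) + (F L - F 0)"
      using step[of "real n * L"] by simp
    with Suc show ?case by (simp add: algebra_simps)
  qed simp
  then show "integral {0..real n * L} f = real n * integral {0..L} f"
    using int[of 0 "real n * L"] int[of 0 L] \<open>0 \<le> L\<close> by simp
qed

section \<open>The Wirtinger inequality\<close>

text \<open>
  For \<open>\<mu> < \<pi>/l\<close>, the function \<open>f(x) = - \<mu> tan (\<mu> (x - c))\<close>, with \<open>c\<close> the midpoint, is smooth on the whole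
  interval and solves the Riccati equation \<open>f' = - \<mu>\<^sup>2 - f\<^sup>2\<close>. Therefore
  \<open>y'\<^sup>2 - \<mu>\<^sup>2 y\<^sup>2 = (y' - f y)\<^sup>2 + (y\<^sup>2 f)'\<close>, and the last term integrates to zero. Letting \<open>\<mu>\<close> tend to
  \<open>\<pi>/l\<close> gives the sharp constant. Taking \<open>\<mu> = \<pi>/l\<close> at once would make \<open>f\<close> singular at the end points.
\<close>

lemma wirtinger_dirichlet:
  fixes y y' :: "real \<Rightarrow> real"
  assumes deriv: "\<And>x. (y has_real_derivative y' x) (at x)"
    and cont: "continuous_on UNIV y'"
    and "0 < l" and zeros: "y a = 0" "y (a + l) = 0"
  shows "(pi / l)\<^sup>2 * integral {a..a + l} (\<lambda>x. (y x)\<^sup>2) \<le> integral {a..a + l} (\<lambda>x. (y' x)\<^sup>2)"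
proof -
  have cy: "continuous_on S y" for S
    using deriv by (meson DERIV_isCont continuous_at_imp_continuous_on)
  have cy': "continuous_on S y'" for S
    using cont continuous_on_subset by blast
  define I where "I = integral {a..a + l} (\<lambda>x. (y x)\<^sup>2)"
  define I' where "I' = integral {a..a + l} (\<lambda>x. (y' x)\<^sup>2)"
  have int_y: "(\<lambda>x. (y x)\<^sup>2) integrable_on {a..a + l}"
    and int_y': "(\<lambda>x. (y' x)\<^sup>2) integrable_on {a..a + l}"
    by (intro integrable_continuous_interval continuous_intros cy cy')+
  have below: "\<mu>\<^sup>2 * I \<le> I'" if \<mu>: "0 < \<mu>" "\<mu> < pi / l" for \<mu>
  proof -
    define f where "f x = - \<mu> * tan (\<mu> * (x - (a + l / 2)))" for x
    have cos_pos: "cos (\<mu> * (x - (a + l / 2))) > 0" if "x \<in> {a..a + l}" for x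
    proof (rule cos_gt_zero_pi)
      have "\<bar>x - (a + l / 2)\<bar> \<le> l / 2" using that unfolding atLeastAtMost_iff by linarith
      then have "\<bar>\<mu> * (x - (a + l / 2))\<bar> \<le> \<mu> * (l / 2)"
        using \<mu> by (simp add: abs_mult)
      moreover have "\<mu> * l < pi" using \<mu> \<open>0 < l\<close> by (simp add: field_simps)
      ultimately show "- (pi / 2) < \<mu> * (x - (a + l / 2))" "\<mu> * (x - (a + l / 2)) < pi / 2"
        by linarith+
    qed
    have f': "(f has_real_derivative - \<mu>\<^sup>2 - (f x)\<^sup>2) (at x)" if "x \<in> {a..a + l}" for x
    proof -
      let ?c = "cos (\<mu> * (x - (a + l / 2)))" and ?s = "sin (\<mu> * (x - (a + l / 2)))"
      have "(f has_real_derivative - \<mu> * (\<mu> * inverse (?c\<^sup>2))) (at x)"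
        unfolding f_def using cos_pos[OF that] by (auto intro!: derivative_eq_intros)
      moreover have "inverse (?c\<^sup>2) = 1 + (tan (\<mu> * (x - (a + l / 2))))\<^sup>2"
        using cos_pos[OF that] by (simp add: tan_sec power_inverse)
      ultimately show ?thesis
        by (simp add: f_def power2_eq_square algebra_simps)
    qed
    have "((\<lambda>x. ((y' x)\<^sup>2 - \<mu>\<^sup>2 * (y x)\<^sup>2) - (y' x - f x * y x)\<^sup>2) has_integral
        ((y (a + l))\<^sup>2 * f (a + l) - (y a)\<^sup>2 * f a)) {a..a + l}"
    proof (rule fundamental_theorem_of_calculus)
      fix x assume x: "x \<in> {a..a + l}"
      have "((\<lambda>x. (y x)\<^sup>2 * f x) has_real_derivative
          ((y' x)\<^sup>2 - \<mu>\<^sup>2 * (y x)\<^sup>2) - (y' x - f x * y x)\<^sup>2) (at x)"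
        by (rule derivative_eq_intros deriv f'[OF x] refl)+
          (simp add: power2_eq_square algebra_simps)
      then show "((\<lambda>x. (y x)\<^sup>2 * f x) has_vector_derivative
          ((y' x)\<^sup>2 - \<mu>\<^sup>2 * (y x)\<^sup>2) - (y' x - f x * y x)\<^sup>2) (at x within {a..a + l})"
        by (auto simp: has_real_derivative_iff_has_vector_derivative
            intro: has_vector_derivative_at_within)
    qed (use \<open>0 < l\<close> in simp)
    then have 1: "((\<lambda>x. ((y' x)\<^sup>2 - \<mu>\<^sup>2 * (y x)\<^sup>2) - (y' x - f x * y x)\<^sup>2) has_integral 0) {a..a + l}"
      by (simp add: zeros)
    have 2: "((\<lambda>x. (y' x)\<^sup>2 - \<mu>\<^sup>2 * (y x)\<^sup>2) has_integral (I' - \<mu>\<^sup>2 * I)) {a..a + l}"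
      unfolding I_def I'_def
      by (intro has_integral_diff has_integral_mult_right integrable_integral int_y int_y')
    have "0 \<le> I' - \<mu>\<^sup>2 * I"
      by (rule has_integral_le[OF 1 2]) simp
    then show ?thesis by simp
  qed
  have "(\<lambda>\<mu>. \<mu>\<^sup>2 * I) \<midarrow>pi / l\<rightarrow> (pi / l)\<^sup>2 * I"
    by (intro tendsto_intros)
  then have "((\<lambda>\<mu>. \<mu>\<^sup>2 * I) \<longlongrightarrow> (pi / l)\<^sup>2 * I) (at_left (pi / l))"
    by (rule filterlim_mono) (auto simp: at_le)
  moreover have "eventually (\<lambda>\<mu>. \<mu>\<^sup>2 * I \<le> I') (at_left (pi / l))"
    using eventually_at_left[of 0 "pi / l"] below \<open>0 < l\<close> by (auto intro!: exI[of _ 0])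
  ultimately have "(pi / l)\<^sup>2 * I \<le> I'"
    by (intro tendsto_upperbound[of _ _ "at_left (pi / l)"]) auto
  then show ?thesis by (simp add: I_def I'_def)
qed

text \<open>
  By the intermediate value theorem a function of period \<open>L\<close> takes some value \<open>c\<close> at two points at
  distance \<open>L/2\<close>. Then \<open>u - c\<close> vanishes at both ends of two intervals of length \<open>L/2\<close> that make up
  a period, and the inequality with zero boundary values applies to each. Subtracting \<open>c\<close> only
  increases the integral of the square, since \<open>u\<close> has mean zero.
\<close>

lemma wirtinger_periodic:
  fixes u u' :: "real \<Rightarrow> real"
  assumes deriv: "\<And>x. (u has_real_derivative u' x) (at x)"
    and cont: "continuous_on UNIV u'"
    and per: "\<And>x. u (x + L) = u x" and "0 < L"
    and mean: "integral {0..L} u = 0"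
  shows "(2 * pi / L)\<^sup>2 * integral {0..L} (\<lambda>x. (u x)\<^sup>2) \<le> integral {0..L} (\<lambda>x. (u' x)\<^sup>2)"
proof -
  have cu: "continuous_on S u" for S
    using deriv by (meson DERIV_isCont continuous_at_imp_continuous_on)
  have cu': "continuous_on S u'" for S
    using cont continuous_on_subset by blast
  have per': "u' (x + L) = u' x" for x
  proof -
    have "((\<lambda>x. u (x + L)) has_real_derivative u' (x + L)) (at x)"
      using deriv[of "x + L"] by (simp add: DERIV_shift)
    then show ?thesis using deriv[of x] per by (simp add: DERIV_unique)
  qed
  obtain a where a: "u (a + L / 2) = u a"
  proof -
    define g where "g x = u (x + L / 2) - u x" for x
    have cg: "continuous_on {0..L / 2} g"
      unfolding g_def by (intro continuous_intros continuous_on_compose2[OF cu[of UNIV]]) auto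
    have "g (L / 2) = - g 0"
      using per[of 0] by (simp add: g_def)
    then consider "g 0 \<le> 0" "0 \<le> g (L / 2)" | "g (L / 2) \<le> 0" "0 \<le> g 0" by linarith
    then obtain x where "g x = 0"
    proof cases
      case 1
      then show ?thesis using IVT'[of g 0 0 "L / 2"] cg \<open>0 < L\<close> that by auto
    next
      case 2
      then show ?thesis using IVT2'[of g "L / 2" 0 0] cg \<open>0 < L\<close> that by auto
    qed
    then show thesis using that by (simp add: g_def)
  qed
  define y where "y x = u x - u a" for x
  have dy: "(y has_real_derivative u' x) (at x)" for x
    unfolding y_def by (auto intro!: derivative_eq_intros deriv)
  have cy: "continuous_on S y" for S
    unfolding y_def by (intro continuous_intros cu)
  have half: "a + L / 2 + L / 2 = a + L" by simp
  have zeros: "y a = 0" "y (a + L / 2) = 0" "y (L + a) = 0"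
    using a per[of a] by (simp_all add: y_def add.commute)
  have split: "integral {a..a + L / 2} f + integral {a + L / 2..a + L} f = integral {0..L} f"
    if "continuous_on UNIV f" "\<And>x. f (x + L) = f x" for f :: "real \<Rightarrow> real"
  proof -
    have "f integrable_on {a..a + L}"
      using that(1) by (intro integrable_continuous_interval) (auto intro: continuous_on_subset)
    then have "integral {a..a + L / 2} f + integral {a + L / 2..a + L} f = integral {a..a + L} f"
      using \<open>0 < L\<close> by (intro Henstock_Kurzweil_Integration.integral_combine) auto
    then show ?thesis using integral_over_period(1)[of f L a] that \<open>0 < L\<close> by simp
  qed
  have c2: "continuous_on UNIV (\<lambda>x. (y x)\<^sup>2)" "continuous_on UNIV (\<lambda>x. (u' x)\<^sup>2)"
    by (intro continuous_intros cy cu')+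
  have "(pi / (L / 2))\<^sup>2 * integral {a..a + L / 2} (\<lambda>x. (y x)\<^sup>2)
      \<le> integral {a..a + L / 2} (\<lambda>x. (u' x)\<^sup>2)"
    by (rule wirtinger_dirichlet[OF dy cont]) (use \<open>0 < L\<close> zeros in auto)
  moreover have "(pi / (L / 2))\<^sup>2 * integral {a + L / 2..a + L / 2 + L / 2} (\<lambda>x. (y x)\<^sup>2)
      \<le> integral {a + L / 2..a + L / 2 + L / 2} (\<lambda>x. (u' x)\<^sup>2)"
    by (rule wirtinger_dirichlet[OF dy cont]) (use \<open>0 < L\<close> zeros half in simp_all)
  ultimately have "(2 * pi / L)\<^sup>2 * (integral {a..a + L / 2} (\<lambda>x. (y x)\<^sup>2) + integral {a + L / 2..a + L} (\<lambda>x. (y x)\<^sup>2))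
      \<le> integral {a..a + L / 2} (\<lambda>x. (u' x)\<^sup>2) + integral {a + L / 2..a + L} (\<lambda>x. (u' x)\<^sup>2)"
    unfolding half by (simp add: distrib_left mult.commute)
  then have main: "(2 * pi / L)\<^sup>2 * integral {0..L} (\<lambda>x. (y x)\<^sup>2) \<le> integral {0..L} (\<lambda>x. (u' x)\<^sup>2)"
    using split[OF c2(1)] split[OF c2(2)] per per' by (simp add: y_def)
  have const: "((\<lambda>x. (u a)\<^sup>2) has_integral L * (u a)\<^sup>2) {0..L}"
    using has_integral_const_real[of "(u a)\<^sup>2" 0 L] \<open>0 < L\<close> by simp
  have "((\<lambda>x. (u x)\<^sup>2 - (2 * u a) * u x + (u a)\<^sup>2) has_integral
      (integral {0..L} (\<lambda>x. (u x)\<^sup>2) - (2 * u a) * integral {0..L} u + L * (u a)\<^sup>2)) {0..L}"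
    by (intro has_integral_add has_integral_diff has_integral_mult_right integrable_integral
        integrable_continuous_interval continuous_intros cu const)
  moreover have "(u x)\<^sup>2 - (2 * u a) * u x + (u a)\<^sup>2 = (y x)\<^sup>2" for x
    by (simp add: y_def power2_eq_square algebra_simps)
  ultimately have "integral {0..L} (\<lambda>x. (y x)\<^sup>2) = integral {0..L} (\<lambda>x. (u x)\<^sup>2) + L * (u a)\<^sup>2"
    using mean by (simp add: integral_unique)
  then have "integral {0..L} (\<lambda>x. (u x)\<^sup>2) \<le> integral {0..L} (\<lambda>x. (y x)\<^sup>2)"
    using \<open>0 < L\<close> by simp
  then have "(2 * pi / L)\<^sup>2 * integral {0..L} (\<lambda>x. (u x)\<^sup>2) \<le> (2 * pi / L)\<^sup>2 * integral {0..L} (\<lambda>x. (y x)\<^sup>2)"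
    by (rule mult_left_mono) simp
  with main show ?thesis by linarith
qed

section \<open>Commuting and self-adjoint operators\<close>

lemma linear_funpow: "linear A \<Longrightarrow> linear (A ^^ n)"
  for A :: "'a::real_vector \<Rightarrow> 'a"
  by (induction n) (auto intro: linear_compose simp: linear_id[unfolded id_def] id_def)

lemma funpow_commute:
  assumes "\<And>x. A (B x) = B (A x)"
  shows "(A ^^ n) (B x) = B ((A ^^ n) x)"
  by (induction n) (simp_all add: assms)

text \<open>
  Linear maps form a noncommutative ring under composition, so the Pascal recursion is carried out for
  the two commuting maps alone.
\<close>

lemma binomial_commuting:
  fixes A B :: "'a::real_vector \<Rightarrow> 'a"
  assumes lin: "linear A" "linear B" and comm: "\<And>x. A (B x) = B (A x)"
  shows "((\<lambda>x. A x + B x) ^^ n) x = (\<Sum>j\<le>n. real (n choose j) *\<^sub>R (A ^^ (n - j)) ((B ^^ j) x))"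
proof (induction n)
  case (Suc n)
  define t where "t i j = (A ^^ i) ((B ^^ j) x)" for i j
  have A: "A (t i j) = t (Suc i) j" and B: "B (t i j) = t i (Suc j)" for i j
    using funpow_commute[of A B i, OF comm] by (simp_all add: t_def)
  have "((\<lambda>x. A x + B x) ^^ Suc n) x =
      A (\<Sum>j\<le>n. real (n choose j) *\<^sub>R t (n - j) j) + B (\<Sum>j\<le>n. real (n choose j) *\<^sub>R t (n - j) j)"
    using Suc by (simp add: t_def)
  also have "\<dots> = (\<Sum>j\<le>n. real (n choose j) *\<^sub>R t (Suc n - j) j) + (\<Sum>j\<le>n. real (n choose j) *\<^sub>R t (n - j) (Suc j))"
    by (simp add: linear_sum[OF lin(1)] linear_sum[OF lin(2)] linear_scale[OF lin(1)] linear_scale[OF lin(2)]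
        A B Suc_diff_le)
  also have "(\<Sum>j\<le>n. real (n choose j) *\<^sub>R t (Suc n - j) j) = t (Suc n) 0 + (\<Sum>j\<le>n. real (n choose Suc j) *\<^sub>R t (n - j) (Suc j))"
  proof -
    have "(\<Sum>j\<le>n. real (n choose j) *\<^sub>R t (Suc n - j) j) = (\<Sum>j\<le>Suc n. real (n choose j) *\<^sub>R t (Suc n - j) j)"
      by simp
    also have "\<dots> = t (Suc n) 0 + (\<Sum>j\<le>n. real (n choose Suc j) *\<^sub>R t (n - j) (Suc j))"
      by (subst sum.atMost_Suc_shift) simp
    finally show ?thesis .
  qed
  also have "t (Suc n) 0 + (\<Sum>j\<le>n. real (n choose Suc j) *\<^sub>R t (n - j) (Suc j))
      + (\<Sum>j\<le>n. real (n choose j) *\<^sub>R t (n - j) (Suc j)) =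
      t (Suc n) 0 + (\<Sum>j\<le>n. real (Suc n choose Suc j) *\<^sub>R t (n - j) (Suc j))"
    by (simp add: sum.distrib[symmetric] scaleR_add_left[symmetric] add.commute add.left_commute)
  also have "\<dots> = (\<Sum>j\<le>Suc n. real (Suc n choose j) *\<^sub>R t (Suc n - j) j)"
    by (subst sum.atMost_Suc_shift) simp
  finally show ?case by (simp add: t_def)
qed simp

definition self_adjoint :: "('a::real_inner \<Rightarrow> 'a) \<Rightarrow> bool" where
  "self_adjoint A \<longleftrightarrow> linear A \<and> (\<forall>x y. A x \<bullet> y = x \<bullet> A y)"

lemma self_adjoint_linear: "self_adjoint A \<Longrightarrow> linear A"
  by (simp add: self_adjoint_def)

lemma self_adjoint_inner: "self_adjoint A \<Longrightarrow> A x \<bullet> y = x \<bullet> A y"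
  by (simp add: self_adjoint_def)

lemma self_adjoint_lincomb:
  assumes "self_adjoint A" "self_adjoint B"
  shows "self_adjoint (\<lambda>x. a *\<^sub>R A x + b *\<^sub>R B x)"
proof -
  have "linear (\<lambda>x. a *\<^sub>R A x + b *\<^sub>R B x)"
    by (intro linear_compose_add linear_compose_scale_right self_adjoint_linear assms)
  then show ?thesis
    unfolding self_adjoint_def
    by (simp add: inner_add_left inner_add_right self_adjoint_inner[OF assms(1)]
        self_adjoint_inner[OF assms(2)])
qed

lemma self_adjoint_funpow:
  assumes "self_adjoint A"
  shows "(A ^^ n) x \<bullet> y = x \<bullet> (A ^^ n) y"
  by (induction n arbitrary: x y)
    (simp_all add: self_adjoint_inner[OF assms], metis funpow_swap1)

text \<open>
  A self-adjoint operator has no nilpotent part: \<open>\<langle>A\<^sup>n x, A\<^sup>n x\<rangle> = \<langle>A\<^sup>n\<^sup>-\<^sup>1 x, A\<^sup>n\<^sup>+\<^sup>1 x\<rangle>\<close>, so that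
  \<open>A\<^sup>n\<^sup>+\<^sup>1 x = 0\<close> implies \<open>A\<^sup>n x = 0\<close> for \<open>n \<ge> 1\<close>.
\<close>

lemma self_adjoint_funpow_zero:
  assumes sa: "self_adjoint A" and "(A ^^ n) x = 0" and "0 < n"
  shows "A x = 0"
  using assms(2,3)
proof (induction n)
  case (Suc n)
  show ?case
  proof (cases n)
    case 0
    with Suc show ?thesis by simp
  next
    case (Suc p)
    have "(A ^^ n) x \<bullet> (A ^^ n) x = (A ^^ p) x \<bullet> (A ^^ Suc n) x"
      unfolding Suc by (simp add: self_adjoint_inner[OF sa])
    then have "(A ^^ n) x = 0" using Suc.prems by (simp only: inner_zero_right inner_eq_zero_iff)
    then show ?thesis using Suc.IH Suc by simp
  qed
qed simp

text \<open>
  A point where a nonnegative quadratic form vanishes is a minimum, hence critical. Concretely, if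
  \<open>y = A x\<close> were nonzero, the form would be negative at \<open>x - s y\<close> for small \<open>s > 0\<close>.
\<close>

lemma nonneg_form_kernel:
  assumes sa: "self_adjoint A" and nonneg: "\<And>x. 0 \<le> x \<bullet> A x" and "x \<bullet> A x = 0"
  shows "A x = 0"
proof (rule ccontr)
  assume "A x \<noteq> 0"
  define y where "y = A x"
  define q where "q = y \<bullet> A y"
  have y: "y \<bullet> y > 0" using \<open>A x \<noteq> 0\<close> by (simp add: y_def)
  have q: "q \<ge> 0" by (simp add: q_def nonneg)
  \<comment> \<open>The form at \<open>x - s y\<close> is \<open>s (s q - 2 \<langle>y, y\<rangle>)\<close>; this \<open>s\<close> keeps \<open>s q\<close> below \<open>\<langle>y, y\<rangle>\<close>, also when \<open>q = 0\<close>.\<close>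
  define s where "s = y \<bullet> y / (q + 1)"
  have s: "s > 0" using y q by (simp add: s_def)
  have "(x - s *\<^sub>R y) \<bullet> A (x - s *\<^sub>R y) = s * (s * q - 2 * (y \<bullet> y))"
  proof -
    have lin: "linear A" by (rule self_adjoint_linear[OF sa])
    have "x \<bullet> A y = y \<bullet> y" "y \<bullet> A x = y \<bullet> y"
      using self_adjoint_inner[OF sa, of x y] by (simp_all add: y_def)
    then show ?thesis
      using assms(3)
      by (simp add: linear_diff[OF lin] linear_scale[OF lin] inner_diff_left inner_diff_right
          q_def algebra_simps)
  qed
  also have "s * q < 2 * (y \<bullet> y)"
  proof -
    have "s * q \<le> s * (q + 1)" using s by (simp add: algebra_simps)
    also have "\<dots> = y \<bullet> y" using q by (simp add: s_def)
    finally show ?thesis using y by linarith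
  qed
  then have "s * (s * q - 2 * (y \<bullet> y)) < 0" using s by (simp add: mult_pos_neg)
  finally show False using nonneg[of "x - s *\<^sub>R y"] by simp
qed

text \<open>
  Moving half of the factors \<open>A\<close> to the left-hand side of the inner product leaves \<open>\<langle>g, g\<rangle>\<close> for even
  \<open>m\<close> and \<open>\<langle>g, A g\<rangle>\<close> for odd \<open>m\<close>, where \<open>g = A\<^sup>p x\<close> with \<open>p = m div 2\<close>. This settles the sign; where the
  form vanishes, so does some power of \<open>A\<close> at \<open>x\<close>, and then \<open>A x = 0\<close>.
\<close>

lemma nonpos_funpow_form:
  assumes sa: "self_adjoint A" and nonpos: "\<And>x. x \<bullet> A x \<le> 0"
  shows "0 \<le> (-1) ^ m * (x \<bullet> (A ^^ m) x)"
    and "0 < m \<Longrightarrow> x \<bullet> (A ^^ m) x = 0 \<Longrightarrow> A x = 0"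
proof -
  define p where "p = m div 2"
  have even: "x \<bullet> (A ^^ m) x = (A ^^ p) x \<bullet> (A ^^ p) x" if "even m"
  proof -
    have "m = p + p" using that by (auto simp: p_def)
    then show ?thesis by (simp add: funpow_add self_adjoint_funpow[OF sa])
  qed
  have odd: "x \<bullet> (A ^^ m) x = (A ^^ p) x \<bullet> A ((A ^^ p) x)" if "odd m"
  proof -
    have "m = p + Suc p" using that unfolding p_def by presburger
    then show ?thesis by (simp only: funpow_add o_apply self_adjoint_funpow[OF sa]) simp
  qed
  show "0 \<le> (-1) ^ m * (x \<bullet> (A ^^ m) x)"
    using even odd nonpos by (cases "even m") auto
  assume m: "0 < m" and zero: "x \<bullet> (A ^^ m) x = 0"
  have "(A ^^ m) x = 0"
  proof (cases "even m")
    case True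
    with even zero have "(A ^^ p) x = 0" by simp
    moreover have "m = p + p" using True by (auto simp: p_def)
    ultimately show ?thesis
      by (simp add: funpow_add linear_0[OF linear_funpow[OF self_adjoint_linear[OF sa]]])
  next
    case False
    let ?B = "\<lambda>x. (-1) *\<^sub>R A x + 0 *\<^sub>R A x"
    have "?B ((A ^^ p) x) = 0"
      by (rule nonneg_form_kernel[OF self_adjoint_lincomb[OF sa sa]])
        (use odd[OF False] zero nonpos in auto)
    then have "(A ^^ Suc p) x = 0" by simp
    moreover have "m = p + Suc p" using False unfolding p_def by presburger
    ultimately show ?thesis
      by (simp only: funpow_add o_apply linear_0[OF linear_funpow[OF self_adjoint_linear[OF sa]]])
  qed
  then show "A x = 0" by (rule self_adjoint_funpow_zero[OF sa _ m])
qed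

section \<open>Smooth functions on the circle\<close>

definition smooth_fun :: "(real \<Rightarrow> real) \<Rightarrow> bool" where
  "smooth_fun f \<longleftrightarrow> (\<forall>n x. (deriv ^^ n) f differentiable (at x))"

text \<open>
  Smoothness is coinductive: a class of functions that is closed under differentiation consists of
  smooth functions. This spares all formulas for higher derivatives below.
\<close>

lemma smooth_fun_coinduct:
  assumes "f \<in> C"
    and step: "\<And>g. g \<in> C \<Longrightarrow> \<exists>g'\<in>C. \<forall>x. (g has_real_derivative g' x) (at x)"
  shows "smooth_fun f"
proof -
  have "(deriv ^^ n) f \<in> C" for n
  proof (induction n)
    case (Suc n)
    obtain g' where "g' \<in> C" "\<forall>x. ((deriv ^^ n) f has_real_derivative g' x) (at x)"
      using step[OF Suc] by blast
    moreover from this have "deriv ((deriv ^^ n) f) = g'"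
      by (auto intro!: ext DERIV_imp_deriv)
    ultimately show ?case by simp
  qed (use assms in simp)
  then show ?thesis
    unfolding smooth_fun_def using step real_differentiable_def by blast
qed

lemma smooth_fun_DERIV:
  assumes "smooth_fun f"
  shows "(f has_real_derivative deriv f x) (at x)"
proof -
  have "f differentiable (at x)" using assms unfolding smooth_fun_def by (metis funpow_0)
  then show ?thesis by (auto simp: real_differentiable_def DERIV_imp_deriv)
qed

lemma smooth_fun_deriv:
  assumes "smooth_fun f"
  shows "smooth_fun (deriv f)"
proof -
  have "(deriv ^^ n) (deriv f) = (deriv ^^ Suc n) f" for n by (simp add: funpow_swap1)
  then show ?thesis using assms unfolding smooth_fun_def by metis
qed

lemma smooth_fun_lincomb:
  assumes "smooth_fun f" "smooth_fun g"
  shows "smooth_fun (\<lambda>x. a * f x + b * g x)"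
proof (rule smooth_fun_coinduct[where C = "{\<lambda>x. a * f x + b * g x |f g. smooth_fun f \<and> smooth_fun g}"])
  fix u assume "u \<in> {\<lambda>x. a * f x + b * g x |f g. smooth_fun f \<and> smooth_fun g}"
  then obtain f g where u: "u = (\<lambda>x. a * f x + b * g x)" and fg: "smooth_fun f" "smooth_fun g" by blast
  have "(u has_real_derivative a * deriv f x + b * deriv g x) (at x)" for x
    unfolding u using fg by (auto intro!: derivative_eq_intros smooth_fun_DERIV)
  with fg smooth_fun_deriv
  show "\<exists>u'\<in>{\<lambda>x. a * f x + b * g x |f g. smooth_fun f \<and> smooth_fun g}.
      \<forall>x. (u has_real_derivative u' x) (at x)"
    by (intro bexI[where x = "\<lambda>x. a * deriv f x + b * deriv g x"]) auto
qed (use assms in blast)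

lemma smooth_fun_const: "smooth_fun (\<lambda>x. c)"
  by (rule smooth_fun_coinduct[where C = "range (\<lambda>c x. c)"]) (auto intro!: derivative_eq_intros)

lemma smooth_fun_shift:
  assumes "smooth_fun f"
  shows "smooth_fun (\<lambda>x. f (x + a))"
proof (rule smooth_fun_coinduct[where C = "{\<lambda>x. f (x + a) |f. smooth_fun f}"])
  fix u assume "u \<in> {\<lambda>x. f (x + a) |f. smooth_fun f}"
  then obtain f where u: "u = (\<lambda>x. f (x + a))" and f: "smooth_fun f" by blast
  have "(u has_real_derivative deriv f (x + a)) (at x)" for x
    unfolding u using smooth_fun_DERIV[OF f, of "x + a"] by (simp add: DERIV_shift)
  with f smooth_fun_deriv
  show "\<exists>u'\<in>{\<lambda>x. f (x + a) |f. smooth_fun f}. \<forall>x. (u has_real_derivative u' x) (at x)"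
    by (intro bexI[where x = "\<lambda>x. deriv f (x + a)"]) auto
qed (use assms in blast)

text \<open>
  The functions of this shape are closed under differentiation, so that support functions
  \<open>x cos \<theta> + y sin \<theta>\<close> of smooth curves are smooth without a Leibniz rule of higher order.
\<close>

lemma smooth_fun_trig:
  assumes "smooth_fun f" "smooth_fun g"
  shows "smooth_fun (\<lambda>x. f x * cos x + g x * sin x)"
proof (rule smooth_fun_coinduct[where C = "{\<lambda>x. f x * cos x + g x * sin x |f g. smooth_fun f \<and> smooth_fun g}"])
  fix u assume "u \<in> {\<lambda>x. f x * cos x + g x * sin x |f g. smooth_fun f \<and> smooth_fun g}"
  then obtain f g where u: "u = (\<lambda>x. f x * cos x + g x * sin x)"
    and fg: "smooth_fun f" "smooth_fun g" by blast
  have "(u has_real_derivative (deriv f x + g x) * cos x + (deriv g x - f x) * sin x) (at x)" for x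
    unfolding u using fg
    by (auto intro!: derivative_eq_intros smooth_fun_DERIV simp: algebra_simps)
  moreover have "smooth_fun (\<lambda>x. deriv f x + g x)" "smooth_fun (\<lambda>x. deriv g x - f x)"
    using smooth_fun_lincomb[OF smooth_fun_deriv[OF fg(1)] fg(2), of 1 1]
      smooth_fun_lincomb[OF smooth_fun_deriv[OF fg(2)] fg(1), of 1 "-1"] by simp_all
  ultimately
  show "\<exists>u'\<in>{\<lambda>x. f x * cos x + g x * sin x |f g. smooth_fun f \<and> smooth_fun g}.
      \<forall>x. (u has_real_derivative u' x) (at x)"
    by (intro bexI[where x = "\<lambda>x. (deriv f x + g x) * cos x + (deriv g x - f x) * sin x"]) auto
qed (use assms in blast)

lemma smooth_fun_continuous_on: "smooth_fun f \<Longrightarrow> continuous_on S f"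
  using smooth_fun_DERIV by (meson DERIV_isCont continuous_at_imp_continuous_on)

lemma periodic_nat:
  fixes f :: "real \<Rightarrow> 'a"
  assumes "\<And>x. f (x + L) = f x"
  shows "f (x + real n * L) = f x"
proof (induction n)
  case (Suc n)
  have "x + real (Suc n) * L = (x + real n * L) + L" by (simp add: algebra_simps)
  then show ?case using assms Suc by metis
qed simp

lemma periodic_int:
  fixes f :: "real \<Rightarrow> 'a"
  assumes "\<And>x. f (x + L) = f x"
  shows "f (x + of_int i * L) = f x"
proof (cases "i \<ge> 0")
  case True
  then show ?thesis using periodic_nat[of f L x "nat i", OF assms] by simp
next
  case False
  then show ?thesis
    using periodic_nat[of f L "x + of_int i * L" "nat (- i)", OF assms] by simp
qed

typedef circle_fun = "{f. smooth_fun f \<and> (\<forall>x. f (x + 2 * pi) = f x)}"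
  morphisms at_angle Abs_circle_fun
  by (rule exI[of _ "\<lambda>x. 0"]) (simp add: smooth_fun_const)

lemma smooth_at_angle: "smooth_fun (at_angle f)"
  and at_angle_periodic: "at_angle f (x + 2 * pi) = at_angle f x"
  using at_angle[of f] by auto

lemma at_angle_Abs:
  "smooth_fun f \<Longrightarrow> (\<And>x. f (x + 2 * pi) = f x) \<Longrightarrow> at_angle (Abs_circle_fun f) = f"
  by (simp add: Abs_circle_fun_inverse)

lemma circle_fun_eqI: "(\<And>x. at_angle f x = at_angle g x) \<Longrightarrow> f = g"
  by (metis at_angle_inject ext)

lemma continuous_at_angle: "continuous_on S (at_angle f)"
  by (rule smooth_fun_continuous_on[OF smooth_at_angle])

lemma integrable_at_angle_mult:
  "(\<lambda>x. at_angle f x * at_angle g x) integrable_on {a..b}"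
  by (intro integrable_continuous_interval continuous_intros continuous_at_angle)

instantiation circle_fun :: real_vector
begin

definition "0 = Abs_circle_fun (\<lambda>x. 0)"
definition "f + g = Abs_circle_fun (\<lambda>x. at_angle f x + at_angle g x)"
definition "- f = Abs_circle_fun (\<lambda>x. - at_angle f x)"
definition "f - g = Abs_circle_fun (\<lambda>x. at_angle f x - at_angle g x)"
definition "c *\<^sub>R f = Abs_circle_fun (\<lambda>x. c * at_angle f x)"

lemma at_angle_arith:
  "at_angle 0 x = 0"
  "at_angle (f + g) x = at_angle f x + at_angle g x"
  "at_angle (- f) x = - at_angle f x"
  "at_angle (f - g) x = at_angle f x - at_angle g x"
  "at_angle (c *\<^sub>R f) x = c * at_angle f x"
proof -
  note lc = smooth_fun_lincomb[OF smooth_at_angle smooth_at_angle]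
  show "at_angle 0 x = 0"
    unfolding zero_circle_fun_def by (subst at_angle_Abs) (auto simp: smooth_fun_const)
  show "at_angle (f + g) x = at_angle f x + at_angle g x"
    unfolding plus_circle_fun_def
    using lc[of 1 f 1 g] by (subst at_angle_Abs) (auto simp: at_angle_periodic)
  show "at_angle (- f) x = - at_angle f x"
    unfolding uminus_circle_fun_def
    using lc[of "-1" f 0 f] by (subst at_angle_Abs) (auto simp: at_angle_periodic)
  show "at_angle (f - g) x = at_angle f x - at_angle g x"
    unfolding minus_circle_fun_def
    using lc[of 1 f "-1" g] by (subst at_angle_Abs) (auto simp: at_angle_periodic)
  show "at_angle (c *\<^sub>R f) x = c * at_angle f x"
    unfolding scaleR_circle_fun_def
    using lc[of c f 0 f] by (subst at_angle_Abs) (auto simp: at_angle_periodic)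
qed

instance
proof
  fix f g e :: circle_fun and r s :: real
  show "f + g + e = f + (g + e)" "f + g = g + f" "0 + f = f" "- f + f = 0" "f - g = f + - g"
    "r *\<^sub>R (f + g) = r *\<^sub>R f + r *\<^sub>R g" "(r + s) *\<^sub>R f = r *\<^sub>R f + s *\<^sub>R f"
    "r *\<^sub>R s *\<^sub>R f = (r * s) *\<^sub>R f" "1 *\<^sub>R f = f"
    by (auto intro!: circle_fun_eqI simp: at_angle_arith algebra_simps)
qed

end

instantiation circle_fun :: real_inner
begin

definition "f \<bullet> g = integral {0..2 * pi} (\<lambda>x. at_angle f x * at_angle g x)"
definition norm_circle_fun :: "circle_fun \<Rightarrow> real" where "norm f = sqrt (f \<bullet> f)" for f :: circle_fun
definition "dist f g = norm (f - g)" for f g :: circle_fun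
definition "sgn f = f /\<^sub>R norm f" for f :: circle_fun
definition uniformity_circle_fun :: "(circle_fun \<times> circle_fun) filter" where
  "uniformity = (INF e\<in>{0<..}. principal {(f :: circle_fun, g). dist f g < e})"
definition open_circle_fun :: "circle_fun set \<Rightarrow> bool" where
  "open U \<longleftrightarrow> (\<forall>f\<in>U. eventually (\<lambda>(f', g). f' = f \<longrightarrow> g \<in> U) uniformity)" for U :: "circle_fun set"

instance
proof
  fix f g e :: circle_fun and r s :: real
  show "f \<bullet> g = g \<bullet> f"
    by (simp add: inner_circle_fun_def mult.commute)
  show "(f + g) \<bullet> e = f \<bullet> e + g \<bullet> e"
    by (simp add: inner_circle_fun_def at_angle_arith algebra_simps
        integral_add[OF integrable_at_angle_mult integrable_at_angle_mult])
  show "(r *\<^sub>R f) \<bullet> g = r * (f \<bullet> g)"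
    by (simp add: inner_circle_fun_def at_angle_arith mult.assoc)
  show "0 \<le> f \<bullet> f"
    by (simp add: inner_circle_fun_def integral_nonneg integrable_at_angle_mult)
  show "f \<bullet> f = 0 \<longleftrightarrow> f = 0"
  proof
    assume "f \<bullet> f = 0"
    then have *: "at_angle f x = 0" if "x \<in> {0..2 * pi}" for x
      using integral_eq_0_iff[of 0 "2 * pi" "\<lambda>x. at_angle f x * at_angle f x"] that
      by (simp add: inner_circle_fun_def continuous_on_mult continuous_at_angle)
    show "f = 0"
    proof (rule circle_fun_eqI)
      fix x :: real
      \<comment> \<open>The integral only controls one period; \<open>y\<close> is the representative of \<open>x\<close> in it.\<close>
      define i where "i = \<lfloor>x / (2 * pi)\<rfloor>"
      define y where "y = x - of_int i * (2 * pi)"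
      have "of_int i \<le> x / (2 * pi)" "x / (2 * pi) < of_int i + 1"
        unfolding i_def by linarith+
      then have y: "y \<in> {0..2 * pi}"
        unfolding y_def by (auto simp: field_simps)
      have "at_angle f x = at_angle f y"
        using periodic_int[of "at_angle f" "2 * pi" y i] at_angle_periodic by (simp add: y_def)
      then show "at_angle f x = at_angle 0 x"
        using *[OF y] by (simp add: at_angle_arith)
    qed
  qed (simp add: inner_circle_fun_def at_angle_arith)
  show "norm f = sqrt (f \<bullet> f)" "dist f g = norm (f - g)" "sgn f = f /\<^sub>R norm f"
    by (simp_all add: norm_circle_fun_def dist_circle_fun_def sgn_circle_fun_def)
qed (simp_all add: uniformity_circle_fun_def open_circle_fun_def)

end

section \<open>Differentiation, rotations and averages on the circle\<close>

definition dif :: "circle_fun \<Rightarrow> circle_fun" where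
  "dif f = Abs_circle_fun (deriv (at_angle f))"

definition rotate_by :: "real \<Rightarrow> circle_fun \<Rightarrow> circle_fun" where
  "rotate_by a f = Abs_circle_fun (\<lambda>x. at_angle f (x + a))"

definition const_one :: circle_fun where
  "const_one = Abs_circle_fun (\<lambda>x. 1)"

lemma at_angle_dif: "at_angle (dif f) x = deriv (at_angle f) x"
proof -
  have "deriv (at_angle f) (x + 2 * pi) = deriv (at_angle f) x" for x
  proof -
    have "((\<lambda>x. at_angle f (x + 2 * pi)) has_real_derivative deriv (at_angle f) (x + 2 * pi)) (at x)"
      using smooth_fun_DERIV[OF smooth_at_angle, of f "x + 2 * pi"] by (simp add: DERIV_shift)
    then show ?thesis by (simp add: at_angle_periodic DERIV_imp_deriv)
  qed
  then show ?thesis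
    unfolding dif_def by (subst at_angle_Abs) (auto intro: smooth_fun_deriv smooth_at_angle)
qed

lemma DERIV_at_angle: "(at_angle f has_real_derivative at_angle (dif f) x) (at x)"
  by (simp add: at_angle_dif smooth_fun_DERIV smooth_at_angle)

lemma dif_eqI:
  assumes "\<And>x. (at_angle f has_real_derivative at_angle g x) (at x)"
  shows "dif f = g"
  using assms by (intro circle_fun_eqI) (metis DERIV_at_angle DERIV_unique)

lemma at_angle_dif_funpow: "at_angle ((dif ^^ r) f) = (deriv ^^ r) (at_angle f)"
  by (induction r) (auto simp: at_angle_dif)

lemma at_angle_rotate_by: "at_angle (rotate_by a f) x = at_angle f (x + a)"
proof -
  have "at_angle f (x + 2 * pi + a) = at_angle f (x + a)" for x
    using at_angle_periodic[of f "x + a"] by (simp add: algebra_simps)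
  then show ?thesis
    unfolding rotate_by_def by (subst at_angle_Abs) (auto intro: smooth_fun_shift smooth_at_angle)
qed

lemma at_angle_const_one: "at_angle const_one x = 1"
  unfolding const_one_def by (subst at_angle_Abs) (auto simp: smooth_fun_const)

lemma at_angle_sum: "at_angle (sum f I) x = (\<Sum>i\<in>I. at_angle (f i) x)"
  by (induction I rule: infinite_finite_induct) (simp_all add: at_angle_arith)

lemma linear_dif: "linear dif"
proof (rule linearI)
  fix f g :: circle_fun and c :: real
  have "at_angle (f + g) = (\<lambda>x. at_angle f x + at_angle g x)"
    by (rule ext) (rule at_angle_arith)
  then show "dif (f + g) = dif f + dif g"
    by (intro dif_eqI) (simp add: at_angle_arith DERIV_add DERIV_at_angle)
  have "at_angle (c *\<^sub>R f) = (\<lambda>x. c * at_angle f x)"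
    by (rule ext) (rule at_angle_arith)
  then show "dif (c *\<^sub>R f) = c *\<^sub>R dif f"
    by (intro dif_eqI) (simp add: at_angle_arith DERIV_cmult DERIV_at_angle)
qed

lemma linear_rotate_by: "linear (rotate_by a)"
  by (rule linearI; rule circle_fun_eqI) (simp_all add: at_angle_arith at_angle_rotate_by)

lemma dif_rotate_by: "dif (rotate_by a f) = rotate_by a (dif f)"
proof (rule dif_eqI)
  fix x
  have "((\<lambda>x. at_angle f (x + a)) has_real_derivative at_angle (dif f) (x + a)) (at x)"
    using DERIV_at_angle[of f "x + a"] by (simp add: DERIV_shift)
  moreover have "at_angle (rotate_by a f) = (\<lambda>x. at_angle f (x + a))"
    by (rule ext) (rule at_angle_rotate_by)
  ultimately show "(at_angle (rotate_by a f) has_real_derivative at_angle (rotate_by a (dif f)) x) (at x)"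
    by (simp add: at_angle_rotate_by)
qed

lemma rotate_by_rotate_by: "rotate_by a (rotate_by b f) = rotate_by (a + b) f"
  by (rule circle_fun_eqI) (simp add: at_angle_rotate_by add.assoc)

lemma rotate_by_0: "rotate_by 0 f = f"
  and rotate_by_2pi: "rotate_by (2 * pi) f = f"
  by (rule circle_fun_eqI; simp add: at_angle_rotate_by at_angle_periodic)+

lemma inner_rotate_by: "rotate_by a f \<bullet> rotate_by a g = f \<bullet> g"
  unfolding inner_circle_fun_def at_angle_rotate_by
  by (rule integral_over_period(2)[of "\<lambda>x. at_angle f x * at_angle g x"])
    (auto simp: at_angle_periodic intro!: continuous_intros continuous_at_angle)

lemma inner_rotate_by_left: "rotate_by a f \<bullet> g = f \<bullet> rotate_by (- a) g"
  using inner_rotate_by[of "- a" "rotate_by a f" g] by (simp add: rotate_by_rotate_by rotate_by_0)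

lemma inner_dif_left: "dif f \<bullet> g = - (f \<bullet> dif g)"
proof -
  have "((\<lambda>x. at_angle (dif f) x * at_angle g x + at_angle f x * at_angle (dif g) x) has_integral
      (at_angle f (2 * pi) * at_angle g (2 * pi) - at_angle f 0 * at_angle g 0)) {0..2 * pi}"
  proof (rule fundamental_theorem_of_calculus)
    fix x
    have "((\<lambda>x. at_angle f x * at_angle g x) has_real_derivative
        at_angle (dif f) x * at_angle g x + at_angle f x * at_angle (dif g) x) (at x)"
      by (auto intro!: derivative_eq_intros DERIV_at_angle)
    then show "((\<lambda>x. at_angle f x * at_angle g x) has_vector_derivative
        at_angle (dif f) x * at_angle g x + at_angle f x * at_angle (dif g) x) (at x within {0..2 * pi})"
      by (auto simp: has_real_derivative_iff_has_vector_derivative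
          intro: has_vector_derivative_at_within)
  qed simp
  moreover have "at_angle f (2 * pi) = at_angle f 0" for f
    using at_angle_periodic[of f 0] by simp
  ultimately have "integral {0..2 * pi}
      (\<lambda>x. at_angle (dif f) x * at_angle g x + at_angle f x * at_angle (dif g) x) = 0"
    by (simp add: integral_unique)
  then show ?thesis
    unfolding inner_circle_fun_def
    by (simp add: integral_add[OF integrable_at_angle_mult integrable_at_angle_mult])
qed

lemma inner_dif_funpow_left: "(dif ^^ r) f \<bullet> g = (-1) ^ r * (f \<bullet> (dif ^^ r) g)"
proof (induction r arbitrary: g)
  case (Suc r)
  have "(dif ^^ Suc r) f \<bullet> g = - ((dif ^^ r) f \<bullet> dif g)"
    by (simp add: inner_dif_left)
  also have "\<dots> = (-1) ^ Suc r * (f \<bullet> (dif ^^ Suc r) g)"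
    by (simp add: Suc funpow_swap1)
  finally show ?case .
qed simp

lemma dif_const_one: "dif const_one = 0"
proof (rule dif_eqI)
  fix x
  have "at_angle const_one = (\<lambda>x. 1)" by (rule ext) (rule at_angle_const_one)
  then show "(at_angle const_one has_real_derivative at_angle 0 x) (at x)"
    by (simp add: at_angle_arith)
qed

lemma inner_const_one_const_one: "const_one \<bullet> const_one = 2 * pi"
  by (simp add: inner_circle_fun_def at_angle_const_one)

lemma inner_const_one_dif: "const_one \<bullet> dif f = 0"
  using inner_dif_left[of const_one f] by (simp add: dif_const_one)

lemma rotate_by_const_one: "rotate_by a const_one = const_one"
  by (rule circle_fun_eqI) (simp add: at_angle_rotate_by at_angle_const_one)

definition mean_part :: "circle_fun \<Rightarrow> circle_fun" where
  "mean_part f = ((const_one \<bullet> f) / (2 * pi)) *\<^sub>R const_one"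

definition rot_avg :: "nat \<Rightarrow> circle_fun \<Rightarrow> circle_fun" where
  "rot_avg k f = (1 / real k) *\<^sub>R (\<Sum>j<k. rotate_by (2 * real j * pi / real k) f)"

text \<open>
  This is the operator \<open>T\<^sub>k\<close>; the factorization through \<open>rot_avg\<close> makes its algebra transparent.
\<close>

definition half_avg :: "nat \<Rightarrow> circle_fun \<Rightarrow> circle_fun" where
  "half_avg k f = rotate_by (pi / real k) (rot_avg k f)"

text \<open>
  The radius of curvature of the curve with support function \<open>f\<close>.
\<close>

definition radius_op :: "circle_fun \<Rightarrow> circle_fun" where
  "radius_op f = f + dif (dif f)"

lemma linear_mean_part: "linear mean_part"
  by (rule linearI) (simp_all add: mean_part_def inner_add_right add_divide_distrib scaleR_add_left)

lemma linear_rot_avg: "linear (rot_avg k)"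
  unfolding rot_avg_def
  by (intro linear_compose_scale_right linear_compose_sum ballI linear_rotate_by)

lemma linear_half_avg: "linear (half_avg k)"
  unfolding half_avg_def
  using linear_compose[OF linear_rot_avg linear_rotate_by] by (simp add: o_def)

lemma linear_radius_op: "linear radius_op"
  unfolding radius_op_def
  using linear_compose_add[OF linear_id linear_compose[OF linear_dif linear_dif]]
  by (simp add: o_def id_def)

lemma dif_rot_avg: "dif (rot_avg k f) = rot_avg k (dif f)"
  by (simp add: rot_avg_def linear_scale[OF linear_dif] linear_sum[OF linear_dif] dif_rotate_by)

lemma rotate_by_rot_avg: "rotate_by a (rot_avg k f) = rot_avg k (rotate_by a f)"
  by (simp add: rot_avg_def linear_scale[OF linear_rotate_by] linear_sum[OF linear_rotate_by]
      rotate_by_rotate_by add.commute)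

lemma radius_op_rot_avg: "radius_op (rot_avg k f) = rot_avg k (radius_op f)"
  by (simp add: radius_op_def dif_rot_avg linear_add[OF linear_rot_avg])

lemma radius_op_half_avg: "radius_op (half_avg k f) = half_avg k (radius_op f)"
  by (simp add: radius_op_def half_avg_def dif_rot_avg dif_rotate_by linear_add[OF linear_rot_avg]
      linear_add[OF linear_rotate_by])

lemma rot_avg_const_one: "0 < k \<Longrightarrow> rot_avg k const_one = const_one"
  by (simp add: rot_avg_def rotate_by_const_one sum_constant_scaleR)

lemma half_avg_const_one: "0 < k \<Longrightarrow> half_avg k const_one = const_one"
  by (simp add: half_avg_def rot_avg_const_one rotate_by_const_one)

text \<open>
  The rotation by \<open>2\<pi>/k\<close> permutes the summands cyclically.
\<close>

lemma rotate_step_rot_avg: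
  assumes "0 < k"
  shows "rotate_by (2 * pi / real k) (rot_avg k f) = rot_avg k f"
proof -
  let ?r = "\<lambda>j. rotate_by (2 * real j * pi / real k) f"
  have "rotate_by (2 * pi / real k) (?r j) = ?r (Suc j)" for j
    by (simp add: rotate_by_rotate_by add_divide_distrib algebra_simps)
  then have "rotate_by (2 * pi / real k) (\<Sum>j<k. ?r j) = (\<Sum>j<k. ?r (Suc j))"
    by (simp add: linear_sum[OF linear_rotate_by])
  moreover have "(\<Sum>j<k. ?r (Suc j)) + ?r 0 = (\<Sum>j<k. ?r j) + ?r k"
    using sum.lessThan_Suc_shift[of ?r k] by (simp add: add.commute)
  moreover have "?r k = ?r 0"
    using assms by (simp add: rotate_by_0 rotate_by_2pi)
  ultimately show ?thesis
    by (simp add: rot_avg_def linear_scale[OF linear_rotate_by])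
qed

lemma rotate_multiple_rot_avg:
  assumes "0 < k"
  shows "rotate_by (2 * real j * pi / real k) (rot_avg k f) = rot_avg k f"
proof (induction j)
  case (Suc j)
  have "2 * real (Suc j) * pi / real k = 2 * pi / real k + 2 * real j * pi / real k"
    by (simp add: add_divide_distrib algebra_simps)
  then have "rotate_by (2 * real (Suc j) * pi / real k) (rot_avg k f) =
      rotate_by (2 * pi / real k) (rotate_by (2 * real j * pi / real k) (rot_avg k f))"
    by (simp only: rotate_by_rotate_by)
  then show ?case using Suc rotate_step_rot_avg[OF assms] by simp
qed (simp add: rotate_by_0)

lemma rot_avg_idem:
  assumes "0 < k"
  shows "rot_avg k (rot_avg k f) = rot_avg k f"
  using assms
  by (subst rot_avg_def) (simp add: rotate_multiple_rot_avg sum_constant_scaleR)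

text \<open>
  Rotations are isometries and fix the average on the left, so each summand of the average on the right
  has the same inner product with it.
\<close>

lemma inner_rot_avg_rot_avg:
  assumes "0 < k"
  shows "rot_avg k f \<bullet> rot_avg k g = rot_avg k f \<bullet> g"
proof -
  have "rot_avg k f \<bullet> rotate_by (2 * real j * pi / real k) g = rot_avg k f \<bullet> g" for j
    using inner_rotate_by[of "2 * real j * pi / real k" "rot_avg k f" g]
      rotate_multiple_rot_avg[OF assms, of j f] by simp
  then show ?thesis
    using assms by (subst (2) rot_avg_def) (simp add: inner_sum_right)
qed

lemma self_adjoint_rot_avg:
  assumes "0 < k"
  shows "self_adjoint (rot_avg k)"
  using linear_rot_avg inner_rot_avg_rot_avg[OF assms]
  unfolding self_adjoint_def by (metis inner_commute)

text \<open>
  Two half steps make a full step, which an average over the full steps absorbs. This is the source of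
  \<open>T\<^sup>3 = T\<close>.
\<close>

lemma half_avg_half_avg:
  assumes "0 < k"
  shows "half_avg k (half_avg k f) = rot_avg k f"
  using rotate_step_rot_avg[OF assms, of f]
  by (simp add: half_avg_def rotate_by_rot_avg[symmetric] rot_avg_idem[OF assms] rotate_by_rotate_by
      flip: add_divide_distrib)

lemma half_avg_rot_avg:
  assumes "0 < k"
  shows "half_avg k (rot_avg k f) = half_avg k f"
  by (simp add: half_avg_def rot_avg_idem[OF assms])

lemma half_avg_funpow:
  assumes "0 < k" "0 < j"
  shows "(half_avg k ^^ j) f = (if odd j then half_avg k f else half_avg k (half_avg k f))"
  using assms(2)
proof (induction j)
  case (Suc j)
  then show ?case
    by (cases "j = 0") (auto simp: half_avg_half_avg[OF assms(1)] half_avg_rot_avg[OF assms(1)])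
qed simp

lemma self_adjoint_half_avg:
  assumes "0 < k"
  shows "self_adjoint (half_avg k)"
proof -
  have "half_avg k f \<bullet> g = f \<bullet> half_avg k g" for f g
  proof -
    have "half_avg k f \<bullet> g = f \<bullet> rot_avg k (rotate_by (- (pi / real k)) g)"
      by (simp add: half_avg_def inner_rotate_by_left self_adjoint_inner[OF self_adjoint_rot_avg[OF assms]])
    also have "rot_avg k (rotate_by (- (pi / real k)) g) =
        rotate_by (- (pi / real k)) (rotate_by (2 * pi / real k) (rot_avg k g))"
        by (subst rotate_step_rot_avg[OF assms]) (simp only: rotate_by_rot_avg)
    also have "\<dots> = half_avg k g"
      by (simp add: rotate_by_rotate_by half_avg_def flip: diff_divide_distrib)
    finally show ?thesis .
  qed
  then show ?thesis by (simp add: self_adjoint_def linear_half_avg)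
qed

lemma self_adjoint_radius_op: "self_adjoint radius_op"
  using linear_radius_op by (simp add: self_adjoint_def radius_op_def inner_add_left inner_add_right inner_dif_left)

lemma self_adjoint_mean_part: "self_adjoint mean_part"
  using linear_mean_part by (simp add: self_adjoint_def mean_part_def inner_commute mult.commute)

section \<open>The spectral gap\<close>

text \<open>
  Functions fixed by the rotation by \<open>2\<pi>/k\<close> have period \<open>2\<pi>/k\<close>, which improves the constant in
  Wirtinger's inequality by the factor \<open>k\<^sup>2\<close>.
\<close>

lemma wirtinger_rot_avg:
  assumes "0 < k" and fixed: "rot_avg k f = f" and mean: "const_one \<bullet> f = 0"
  shows "(real k)\<^sup>2 * (f \<bullet> f) \<le> dif f \<bullet> dif f"
proof -
  define L where "L = 2 * pi / real k"
  have L: "0 < L" "real k * L = 2 * pi" using \<open>0 < k\<close> by (simp_all add: L_def)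
  have rot: "rotate_by L f = f"
    using rotate_step_rot_avg[OF \<open>0 < k\<close>, of f] fixed by (simp add: L_def)
  then have per: "at_angle f (x + L) = at_angle f x" for x
    by (metis at_angle_rotate_by)
  have per': "at_angle (dif f) (x + L) = at_angle (dif f) x" for x
    by (metis at_angle_rotate_by dif_rotate_by rot)
  have period: "integral {0..2 * pi} g = real k * integral {0..L} g"
    if "continuous_on UNIV g" "\<And>x. g (x + L) = g x" for g :: "real \<Rightarrow> real"
    using integral_over_period(3)[of g L k] that L by simp
  have int0: "integral {0..L} (at_angle f) = 0"
    using mean period[OF continuous_at_angle, of f] per \<open>0 < k\<close>
    by (simp add: inner_circle_fun_def at_angle_const_one)
  define I where "I = integral {0..L} (\<lambda>x. (at_angle f x)\<^sup>2)"
  define I' where "I' = integral {0..L} (\<lambda>x. (at_angle (dif f) x)\<^sup>2)"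
  have "(2 * pi / L)\<^sup>2 * I \<le> I'"
    unfolding I_def I'_def
    by (rule wirtinger_periodic[OF DERIV_at_angle continuous_at_angle per L(1) int0])
  moreover have "2 * pi / L = real k" using \<open>0 < k\<close> by (simp add: L_def)
  ultimately have "real k * ((real k)\<^sup>2 * I) \<le> real k * I'"
    by (simp add: mult_left_mono)
  moreover have "f \<bullet> f = real k * I"
    using period[of "\<lambda>x. (at_angle f x)\<^sup>2"] per unfolding I_def
    by (simp add: inner_circle_fun_def power2_eq_square continuous_on_mult continuous_at_angle)
  moreover have "dif f \<bullet> dif f = real k * I'"
    using period[of "\<lambda>x. (at_angle (dif f) x)\<^sup>2"] per' unfolding I'_def
    by (simp add: inner_circle_fun_def power2_eq_square continuous_on_mult continuous_at_angle)
  ultimately show ?thesis by (metis mult.left_commute)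
qed

lemma rot_avg_1: "rot_avg 1 f = f"
  by (simp add: rot_avg_def rotate_by_0)

lemma wirtinger_circle: "const_one \<bullet> f = 0 \<Longrightarrow> f \<bullet> f \<le> dif f \<bullet> dif f"
  using wirtinger_rot_avg[OF zero_less_one rot_avg_1, of f] by simp

lemma inner_radius_op: "f \<bullet> radius_op g = f \<bullet> g - dif f \<bullet> dif g"
  by (simp add: radius_op_def inner_add_right inner_dif_left)

lemma radius_op_const_one: "radius_op const_one = const_one"
  by (simp add: radius_op_def dif_const_one linear_0[OF linear_dif])

text \<open>
  Wirtinger's inequality says that the quadratic form of \<open>M - R\<close>, with \<open>M\<close> the mean value and \<open>R\<close> the
  radius operator, is nonnegative on all functions. Equality therefore puts \<open>f\<close> into the kernel of
  \<open>M - R\<close>, and no differential equation has to be solved.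
\<close>

lemma wirtinger_equality:
  assumes mean: "const_one \<bullet> f = 0" and eq: "dif f \<bullet> dif f = f \<bullet> f"
  shows "radius_op f = 0"
proof -
  let ?B = "\<lambda>g. 1 *\<^sub>R mean_part g + (-1) *\<^sub>R radius_op g"
  have B: "g \<bullet> ?B g = dif g \<bullet> dif g - g \<bullet> g + g \<bullet> mean_part g" for g
    by (simp add: inner_diff_right inner_radius_op)
  have "?B f = 0"
  proof (rule nonneg_form_kernel[OF self_adjoint_lincomb[OF self_adjoint_mean_part self_adjoint_radius_op]])
    show "f \<bullet> ?B f = 0"
      unfolding B using mean eq by (simp add: mean_part_def)
    fix g
    define g0 where "g0 = g - mean_part g"
    have one: "const_one \<bullet> g0 = 0"
      by (simp add: g0_def mean_part_def inner_diff_right inner_const_one_const_one)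
    have d: "dif g0 = dif g"
      by (simp add: g0_def mean_part_def linear_diff[OF linear_dif] linear_scale[OF linear_dif] dif_const_one)
    have "g0 \<bullet> mean_part g = 0"
      using one by (simp add: mean_part_def inner_commute)
    then have "g0 \<bullet> g0 = g \<bullet> g - g \<bullet> mean_part g"
      by (simp add: g0_def inner_diff_right inner_diff_left inner_commute)
    then show "0 \<le> g \<bullet> ?B g"
      unfolding B using wirtinger_circle[OF one] d by simp
  qed
  then show ?thesis using mean by (simp add: mean_part_def)
qed

definition gap_op :: "nat \<Rightarrow> circle_fun \<Rightarrow> circle_fun" where
  "gap_op k f = radius_op f - half_avg k f"

lemma self_adjoint_gap_op:
  assumes "0 < k"
  shows "self_adjoint (gap_op k)"
proof -
  have "gap_op k = (\<lambda>f. 1 *\<^sub>R radius_op f + (-1) *\<^sub>R half_avg k f)"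
    by (simp add: gap_op_def fun_eq_iff)
  then show ?thesis
    using self_adjoint_lincomb[OF self_adjoint_radius_op self_adjoint_half_avg[OF assms]] by metis
qed

text \<open>
  The parts \<open>z\<close>, \<open>v\<close> and the mean value \<open>M\<close> of \<open>f\<close> are orthogonal, and so are their derivatives.
  The terms in \<open>M\<close> cancel, \<open>half_avg k\<close> annihilates \<open>z\<close> and acts on \<open>v\<close> as an isometry, whence
  \<open>\<langle>v, T v\<rangle> \<ge> - \<langle>v, v\<rangle>\<close>. What is left for \<open>v\<close> is at least
  \<open>\<langle>v', v'\<rangle> - 2 \<langle>v, v\<rangle> \<ge> (k\<^sup>2 - 2) \<langle>v, v\<rangle>\<close>, and \<open>k \<ge> 2\<close>.
\<close>

lemma gap_form_bound:
  fixes f :: circle_fun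
  assumes "2 \<le> k"
  defines "z \<equiv> f - rot_avg k f" and "v \<equiv> rot_avg k f - mean_part f"
  shows "- (f \<bullet> gap_op k f) \<ge> (dif z \<bullet> dif z - z \<bullet> z) + 2 * (v \<bullet> v)"
    and "const_one \<bullet> z = 0"
proof -
  have k: "0 < k" using assms by simp
  note sa = self_adjoint_inner[OF self_adjoint_rot_avg[OF k]]
  define M where "M = mean_part f"
  have one_S: "const_one \<bullet> rot_avg k g = const_one \<bullet> g" for g
    using sa[of const_one g] by (simp add: rot_avg_const_one[OF k])
  show "const_one \<bullet> z = 0" by (simp add: z_def inner_diff_right one_S)
  have Sz: "rot_avg k z = 0"
    by (simp add: z_def linear_diff[OF linear_rot_avg] rot_avg_idem[OF k])
  have SM: "rot_avg k M = M"
    by (simp add: M_def mean_part_def linear_scale[OF linear_rot_avg] rot_avg_const_one[OF k])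
  have Sv: "rot_avg k v = v"
    by (simp add: v_def linear_diff[OF linear_rot_avg] rot_avg_idem[OF k] SM flip: M_def)
  have one_v: "const_one \<bullet> v = 0"
    by (simp add: v_def mean_part_def inner_diff_right one_S inner_const_one_const_one)
  have Mv: "M \<bullet> v = 0" "v \<bullet> M = 0"
    using one_v by (simp_all add: M_def mean_part_def inner_commute)
  have zS: "z \<bullet> g = 0" if "rot_avg k g = g" for g
    using sa[of z g] Sz that by simp
  have orth: "z \<bullet> v = 0" "v \<bullet> z = 0" "z \<bullet> M = 0" "M \<bullet> z = 0"
    using zS[OF Sv] zS[OF SM] by (simp_all add: inner_commute)
  have dM: "dif M = 0"
    by (simp add: M_def mean_part_def linear_scale[OF linear_dif] dif_const_one)
  have f: "f = z + (v + M)" by (simp add: z_def v_def M_def)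
  have df: "dif f = dif z + dif v"
    by (subst f) (simp add: linear_add[OF linear_dif] dM)
  have "dif z \<bullet> dif v = 0"
    using zS[of "dif (dif v)"] Sv by (simp add: inner_dif_left dif_rot_avg[symmetric])
  then have e1: "dif f \<bullet> dif f = dif z \<bullet> dif z + dif v \<bullet> dif v"
    by (simp add: df inner_add_left inner_add_right inner_commute)
  have e2: "f \<bullet> f = z \<bullet> z + v \<bullet> v + M \<bullet> M"
    by (subst (1 2) f) (simp add: inner_add_left inner_add_right orth Mv)
  have Tz: "half_avg k z = 0" by (simp add: half_avg_def Sz linear_0[OF linear_rotate_by])
  have TM: "half_avg k M = M"
    by (simp add: M_def mean_part_def linear_scale[OF linear_half_avg] half_avg_const_one[OF k])
  have Tv: "half_avg k v = rotate_by (pi / real k) v" by (simp add: half_avg_def Sv)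
  have Tf: "half_avg k f = half_avg k v + M"
    by (subst f) (simp add: linear_add[OF linear_half_avg] Tz TM)
  have zT: "z \<bullet> half_avg k g = 0" for g
    using self_adjoint_inner[OF self_adjoint_half_avg[OF k], of z g] Tz by simp
  have MT: "M \<bullet> half_avg k v = 0"
    using self_adjoint_inner[OF self_adjoint_half_avg[OF k], of M v] TM Mv by simp
  have e3: "f \<bullet> half_avg k f = v \<bullet> half_avg k v + M \<bullet> M"
    unfolding Tf
    by (subst f) (simp add: inner_add_left inner_add_right zT orth MT Mv)
  have "\<bar>v \<bullet> half_avg k v\<bar> \<le> norm v * norm (half_avg k v)" by (rule Cauchy_Schwarz_ineq2)
  also have "norm (half_avg k v) = norm v" unfolding Tv by (simp add: norm_eq_sqrt_inner inner_rotate_by)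
  finally have e4: "v \<bullet> half_avg k v \<ge> - (v \<bullet> v)" by (simp add: dot_square_norm power2_eq_square)
  have "4 * (v \<bullet> v) \<le> (real k)\<^sup>2 * (v \<bullet> v)"
  proof (rule mult_right_mono)
    have "2\<^sup>2 \<le> (real k)\<^sup>2" using assms by (intro power_mono) auto
    then show "4 \<le> (real k)\<^sup>2" by simp
  qed simp
  then have "4 * (v \<bullet> v) \<le> dif v \<bullet> dif v"
    using wirtinger_rot_avg[OF k Sv one_v] by linarith
  then show "- (f \<bullet> gap_op k f) \<ge> (dif z \<bullet> dif z - z \<bullet> z) + 2 * (v \<bullet> v)"
    using e1 e2 e3 e4 by (simp add: gap_op_def inner_diff_right inner_radius_op)
qed

lemma gap_op_nonpos:
  assumes "2 \<le> k"
  shows "f \<bullet> gap_op k f \<le> 0"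
  using gap_form_bound[OF assms, of f] wirtinger_circle[of "f - rot_avg k f"]
    inner_ge_zero[of "rot_avg k f - mean_part f"] by linarith

text \<open>
  If the form vanishes at \<open>f\<close>, then \<open>f\<close> is its mean value plus an extremal of Wirtinger's inequality,
  on which the radius operator is zero. Conversely, subtract the constant from \<open>f\<close> to reach a
  function \<open>g\<close> with \<open>R g = 0\<close>; its rotational average satisfies the same equation, and the improved
  Wirtinger inequality leaves no such function of period \<open>2\<pi>/k\<close> except zero.
\<close>

lemma gap_op_kernel:
  assumes "2 \<le> k"
  shows "gap_op k f = 0 \<longleftrightarrow> (\<exists>c. radius_op f = c *\<^sub>R const_one)"
proof
  assume 0: "gap_op k f = 0"
  define z where "z = f - rot_avg k f"
  define v where "v = rot_avg k f - mean_part f"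
  have one_z: "const_one \<bullet> z = 0" using gap_form_bound(2)[OF assms] by (simp add: z_def)
  have "(dif z \<bullet> dif z - z \<bullet> z) + 2 * (v \<bullet> v) \<le> 0"
    using gap_form_bound(1)[OF assms, of f] 0 by (simp add: z_def v_def)
  then have "dif z \<bullet> dif z = z \<bullet> z" "v \<bullet> v = 0"
    using wirtinger_circle[OF one_z] inner_ge_zero[of v] by linarith+
  then have "radius_op z = 0" "v = 0" using wirtinger_equality[OF one_z] by auto
  moreover have "f = z + (v + mean_part f)" by (simp add: z_def v_def)
  ultimately have "radius_op f = radius_op (mean_part f)"
    using linear_add[OF linear_radius_op, of z "mean_part f"] by simp
  then show "\<exists>c. radius_op f = c *\<^sub>R const_one"
    by (auto simp: mean_part_def linear_scale[OF linear_radius_op] radius_op_const_one)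
next
  assume "\<exists>c. radius_op f = c *\<^sub>R const_one"
  then obtain c where c: "radius_op f = c *\<^sub>R const_one" by blast
  have k: "0 < k" using assms by simp
  define g where "g = f - c *\<^sub>R const_one"
  have lap_g: "radius_op g = 0"
    by (simp add: g_def linear_diff[OF linear_radius_op] linear_scale[OF linear_radius_op] radius_op_const_one c)
  define v where "v = rot_avg k g"
  have lap_v: "radius_op v = 0"
    by (simp add: v_def radius_op_rot_avg lap_g linear_0[OF linear_rot_avg])
  have "const_one \<bullet> v = const_one \<bullet> radius_op v"
    by (simp add: radius_op_def inner_add_right inner_const_one_dif)
  then have "const_one \<bullet> v = 0" by (simp add: lap_v)
  then have "(real k)\<^sup>2 * (v \<bullet> v) \<le> dif v \<bullet> dif v"
    by (intro wirtinger_rot_avg[OF k]) (simp_all add: v_def rot_avg_idem[OF k])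
  moreover have "dif v \<bullet> dif v = v \<bullet> v"
    using inner_radius_op[of v v] by (simp add: lap_v)
  moreover have "4 * (v \<bullet> v) \<le> (real k)\<^sup>2 * (v \<bullet> v)"
  proof (rule mult_right_mono)
    have "2\<^sup>2 \<le> (real k)\<^sup>2" using assms by (intro power_mono) auto
    then show "4 \<le> (real k)\<^sup>2" by simp
  qed simp
  ultimately have "v \<bullet> v = 0" using inner_ge_zero[of v] by linarith
  then have "half_avg k g = 0"
    by (simp add: half_avg_def linear_0[OF linear_rotate_by] flip: v_def)
  moreover have "f = g + c *\<^sub>R const_one" by (simp add: g_def)
  ultimately have "half_avg k f = c *\<^sub>R const_one"
    by (simp add: linear_add[OF linear_half_avg] linear_scale[OF linear_half_avg] half_avg_const_one[OF k])
  then show "gap_op k f = 0" by (simp add: gap_op_def c)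
qed

section \<open>Expanding powers of the operator\<close>

text \<open>
  Moving \<open>r\<close> derivatives to the right absorbs the sign \<open>(-1)\<^sup>r\<close> and leaves the binomial expansion of
  the power of \<open>1 + (d/d\<theta>)\<^sup>2\<close>. The summation may run up to any \<open>N \<ge> n\<close>, because the further binomial
  coefficients are zero.
\<close>

lemma sum_inner_dif_radius_op:
  assumes "n \<le> N"
  shows "(\<Sum>r=0..N. (-1) ^ r * real (n choose r) * ((dif ^^ r) f \<bullet> radius_op ((dif ^^ r) g)))
    = f \<bullet> (radius_op ^^ Suc n) g"
proof -
  let ?D = "\<lambda>f. dif (dif f)"
  have lin: "linear ?D" using linear_compose[OF linear_dif linear_dif] by (simp add: o_def)
  have radius_op_dif: "radius_op (dif x) = dif (radius_op x)" for x
    by (simp add: radius_op_def linear_add[OF linear_dif])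
  have D: "(dif ^^ r) ((dif ^^ r) x) = (?D ^^ r) x" for r x
  proof -
    have "?D = dif ^^ 2" by (simp add: fun_eq_iff numeral_2_eq_2)
    then have "(?D ^^ r) x = (dif ^^ (r + r)) x" by (simp add: funpow_mult mult_2)
    then show ?thesis by (simp add: funpow_add)
  qed
  have summand: "(-1) ^ r * ((dif ^^ r) f \<bullet> radius_op ((dif ^^ r) g)) = f \<bullet> radius_op ((?D ^^ r) g)" for r
    using funpow_commute[of dif radius_op, OF radius_op_dif[symmetric]]
    by (simp add: inner_dif_funpow_left D)
  have radius_op_split: "radius_op = (\<lambda>x. id x + ?D x)" by (simp add: radius_op_def fun_eq_iff)
  have "(radius_op ^^ n) g = (\<Sum>r\<le>n. real (n choose r) *\<^sub>R (id ^^ (n - r)) ((?D ^^ r) g))"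
    unfolding radius_op_split by (rule binomial_commuting[OF linear_id lin]) simp
  then have "f \<bullet> (radius_op ^^ Suc n) g = (\<Sum>r\<le>n. real (n choose r) * (f \<bullet> radius_op ((?D ^^ r) g)))"
    by (simp add: linear_sum[OF linear_radius_op] linear_scale[OF linear_radius_op] inner_sum_right)
  also have "\<dots> = (\<Sum>r=0..N. real (n choose r) * (f \<bullet> radius_op ((?D ^^ r) g)))"
    using assms by (intro sum.mono_neutral_left) (auto simp: not_le)
  finally show ?thesis by (simp add: summand[symmetric] mult.assoc mult.left_commute)
qed

text \<open>
  Expanding \<open>(R - T)\<^sup>m\<close> gives the signs \<open>(-1)\<^sup>j\<close>, and \<open>T\<^sup>j\<close> depends only on the parity of \<open>j \<ge> 1\<close>. The
  terms \<open>j = 0\<close> and \<open>j = m\<close> are separate since they come from the areas and from the widths.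
\<close>

lemma gap_op_power_expansion:
  assumes "0 < k" "1 \<le> m"
  shows "f \<bullet> (gap_op k ^^ m) f =
      f \<bullet> (radius_op ^^ m) f
    + (if even m then f \<bullet> half_avg k (half_avg k f) else - (f \<bullet> half_avg k f))
    + (\<Sum>j\<in>{j. 1 \<le> j \<and> j \<le> m - 1 \<and> even j}. real (m choose j) * (f \<bullet> (radius_op ^^ (m - j)) (half_avg k (half_avg k f))))
    - (\<Sum>j\<in>{j. 1 \<le> j \<and> j \<le> m - 1 \<and> odd j}. real (m choose j) * (f \<bullet> (radius_op ^^ (m - j)) (half_avg k f)))"
proof -
  let ?T = "half_avg k" and ?N = "\<lambda>x. - half_avg k x"
  have linN: "linear ?N" by (rule linear_compose_neg[OF linear_half_avg])
  have comm: "radius_op (?N x) = ?N (radius_op x)" for x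
    by (simp add: linear_neg[OF linear_radius_op] radius_op_half_avg)
  have N: "(?N ^^ j) x = (-1) ^ j *\<^sub>R (?T ^^ j) x" for j x
    by (induction j) (simp_all add: linear_scale[OF linear_half_avg])
  define t where "t j = real (m choose j) * ((-1) ^ j * (f \<bullet> (radius_op ^^ (m - j)) ((?T ^^ j) f)))" for j
  have "gap_op k = (\<lambda>x. radius_op x + ?N x)" by (simp add: gap_op_def fun_eq_iff)
  then have "f \<bullet> (gap_op k ^^ m) f = (\<Sum>j\<le>m. t j)"
    using binomial_commuting[OF linear_radius_op linN comm, of m f]
    by (simp add: inner_sum_right N linear_scale[OF linear_funpow[OF linear_radius_op]] t_def mult.assoc)
  also have "{..m} = insert 0 (insert m {1..m - 1})" using assms by auto
  also have "sum t \<dots> = t 0 + t m + sum t {1..m - 1}" using assms by simp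
  also have "{1..m - 1} = {j. 1 \<le> j \<and> j \<le> m - 1 \<and> even j} \<union> {j. 1 \<le> j \<and> j \<le> m - 1 \<and> odd j}"
    (is "_ = ?E \<union> ?O") by auto
  also have "sum t \<dots> = sum t ?E + sum t ?O" by (rule sum.union_disjoint) auto
  also have "sum t ?E = (\<Sum>j\<in>?E. real (m choose j) * (f \<bullet> (radius_op ^^ (m - j)) (?T (?T f))))"
    by (rule sum.cong) (auto simp: t_def half_avg_funpow[OF assms(1)])
  also have "sum t ?O = - (\<Sum>j\<in>?O. real (m choose j) * (f \<bullet> (radius_op ^^ (m - j)) (?T f)))"
    unfolding sum_negf[symmetric]
    by (rule sum.cong) (auto simp: t_def half_avg_funpow[OF assms(1)])
  also have "t 0 = f \<bullet> (radius_op ^^ m) f" by (simp add: t_def)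
  also have "t m = (if even m then f \<bullet> ?T (?T f) else - (f \<bullet> ?T f))"
    using assms by (simp add: t_def half_avg_funpow[OF assms(1)])
  finally show ?thesis by simp
qed

section \<open>Curves and their support functions\<close>

lemma inner_real2: "x \<bullet> y = x $ 1 * y $ 1 + x $ 2 * y $ 2" for x y :: "real^2"
  by (simp add: inner_vec_def sum_2)

lemma nvec_nth [simp]: "nvec a $ 1 = cos a" "nvec a $ 2 = sin a"
  and tvec_nth [simp]: "tvec a $ 1 = - sin a" "tvec a $ 2 = cos a"
  and rot90_nth [simp]: "rot90 v $ 1 = - (v $ 2)" "rot90 v $ 2 = v $ 1"
  by (simp_all add: nvec_def tvec_def rot90_def)

lemma vec2_eqI: "x $ 1 = y $ 1 \<Longrightarrow> x $ 2 = y $ 2 \<Longrightarrow> x = y" for x y :: "real^2"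
  by (simp add: vec_eq_iff forall_2)

lemma linear_rot90: "linear rot90"
  by (rule linearI) (auto intro!: vec2_eqI)

lemma rot90_nvec: "rot90 (nvec a) = tvec a"
  and rot90_tvec: "rot90 (tvec a) = - nvec a"
  by (auto intro!: vec2_eqI)

lemma inner_rot90_funpow: "(rot90 ^^ r) v \<bullet> (rot90 ^^ r) w = v \<bullet> w"
  by (induction r) (simp_all add: inner_real2)

lemma tvec_inner_tvec: "tvec a \<bullet> tvec a = 1"
  using sin_cos_squared_add[of a] by (simp add: inner_real2 power2_eq_square)

lemma nvec_inner_nvec: "nvec a \<bullet> nvec a = 1"
  using sin_cos_squared_add[of a] by (simp add: inner_real2 power2_eq_square)

lemma tvec_inner_nvec: "tvec a \<bullet> nvec a = 0"
  by (simp add: inner_real2)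

lemma nvec_derivative: "(nvec has_vector_derivative tvec a) (at a)"
proof -
  have n: "nvec = (\<lambda>a. cos a *\<^sub>R axis 1 1 + sin a *\<^sub>R axis 2 1)"
    by (rule ext) (rule vec2_eqI; simp add: axis_def)
  have t: "tvec a = (cos a *\<^sub>R 0 + (- sin a) *\<^sub>R axis 1 1) + (sin a *\<^sub>R 0 + cos a *\<^sub>R axis 2 1)"
    by (rule vec2_eqI; simp add: axis_def)
  show ?thesis
    unfolding n t
    by (intro has_vector_derivative_add has_vector_derivative_scaleR has_vector_derivative_const
        DERIV_cos DERIV_sin)
qed

lemma tvec_derivative: "(tvec has_vector_derivative - nvec a) (at a)"
proof -
  have "tvec = (\<lambda>a. rot90 (nvec a))" by (simp add: rot90_nvec)
  then show ?thesis
    using bounded_linear.has_vector_derivative[OF linear_conv_bounded_linear[THEN iffD1, OF linear_rot90]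
        nvec_derivative[of a]] by (simp add: rot90_tvec)
qed

text \<open>
  The derivative of \<open>J\<^sup>r (a n + b t)\<close> is tangential, that is, a multiple of \<open>J\<^sup>r t\<close>, exactly because
  \<open>b = a'\<close>.
\<close>

lemma frame_derivative:
  assumes a: "(a has_real_derivative b x) (at x)" and b: "(b has_real_derivative c) (at x)"
  shows "((\<lambda>x. (rot90 ^^ r) (a x *\<^sub>R nvec x + b x *\<^sub>R tvec x)) has_vector_derivative
    (rot90 ^^ r) ((a x + c) *\<^sub>R tvec x)) (at x)"
proof -
  have "((\<lambda>x. a x *\<^sub>R nvec x + b x *\<^sub>R tvec x) has_vector_derivative
      (a x *\<^sub>R tvec x + b x *\<^sub>R nvec x) + (b x *\<^sub>R (- nvec x) + c *\<^sub>R tvec x)) (at x)"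
    by (intro has_vector_derivative_add has_vector_derivative_scaleR a b nvec_derivative tvec_derivative)
  then have "((\<lambda>x. a x *\<^sub>R nvec x + b x *\<^sub>R tvec x) has_vector_derivative (a x + c) *\<^sub>R tvec x) (at x)"
    by (simp add: scaleR_add_left)
  then show ?thesis
    using bounded_linear.has_vector_derivative linear_funpow[OF linear_rot90, of r]
      linear_conv_bounded_linear by blast
qed

lemma curve_of_support_inner_nvec:
  "curve_of_support g b \<bullet> nvec a = g b * cos (a - b) + deriv g b * sin (a - b)"
  by (simp add: curve_of_support_def inner_real2 cos_diff sin_diff algebra_simps)

text \<open>
  Each passage to the curvature centres replaces the support function by its derivative and turns the
  frame by \<open>J\<close>: subtracting the radius \<open>(a + a'') J\<^sup>r n\<close> from \<open>J\<^sup>r (a n + a' t)\<close> leaves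
  \<open>J\<^sup>r (a' t - a'' n) = J\<^sup>r\<^sup>+\<^sup>1 (a' n + a'' t)\<close>.
\<close>

lemma curv_locus_curve_of_support:
  assumes "smooth_fun h"
  shows "curv_locus r (curve_of_support h) =
    (\<lambda>x. (rot90 ^^ r) ((deriv ^^ r) h x *\<^sub>R nvec x + (deriv ^^ Suc r) h x *\<^sub>R tvec x))"
    and "vderiv (curv_locus r (curve_of_support h)) x =
      (rot90 ^^ r) (((deriv ^^ r) h x + (deriv ^^ Suc (Suc r)) h x) *\<^sub>R tvec x)"
proof -
  define E where "E r x = (rot90 ^^ r) ((deriv ^^ r) h x *\<^sub>R nvec x + (deriv ^^ Suc r) h x *\<^sub>R tvec x)" for r x
  have D: "((deriv ^^ r) h has_real_derivative (deriv ^^ Suc r) h x) (at x)" for r x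
  proof -
    have "smooth_fun ((deriv ^^ r) h)" by (induction r) (use assms smooth_fun_deriv in auto)
    then show ?thesis using smooth_fun_DERIV by simp
  qed
  have E': "vderiv (E r) x = (rot90 ^^ r) (((deriv ^^ r) h x + (deriv ^^ Suc (Suc r)) h x) *\<^sub>R tvec x)" for r x
    using frame_derivative[OF D D, where r = r] unfolding vderiv_def E_def[abs_def]
    by (rule vector_derivative_at)
  have "curv_locus r (curve_of_support h) = E r"
  proof (induction r)
    case (Suc r)
    show ?case
    proof
      fix x
      let ?J = "rot90 ^^ r"
      define \<rho> where "\<rho> = (deriv ^^ r) h x + (deriv ^^ Suc (Suc r)) h x"
      have lin: "linear ?J" by (rule linear_funpow[OF linear_rot90])
      have J: "(rot90 ^^ Suc r) v = ?J (rot90 v)" for v by (simp add: funpow_swap1)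
      have "vderiv (E r) x \<bullet> (rot90 ^^ Suc r) (nvec x) = \<rho>"
        unfolding E' J rot90_nvec inner_rot90_funpow by (simp add: tvec_inner_tvec \<rho>_def)
      then have "curv_locus (Suc r) (curve_of_support h) x = E r x - \<rho> *\<^sub>R ?J (nvec x)"
        using Suc by simp
      also have "\<dots> = ?J (((deriv ^^ r) h x *\<^sub>R nvec x + (deriv ^^ Suc r) h x *\<^sub>R tvec x) - \<rho> *\<^sub>R nvec x)"
        by (simp only: E_def linear_diff[OF lin] linear_scale[OF lin])
      also have "((deriv ^^ r) h x *\<^sub>R nvec x + (deriv ^^ Suc r) h x *\<^sub>R tvec x) - \<rho> *\<^sub>R nvec x =
          rot90 ((deriv ^^ Suc r) h x *\<^sub>R nvec x + (deriv ^^ Suc (Suc r)) h x *\<^sub>R tvec x)"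
        by (rule vec2_eqI) (simp_all add: \<rho>_def algebra_simps)
      finally show "curv_locus (Suc r) (curve_of_support h) x = E (Suc r) x"
        unfolding E_def J .
    qed
  qed (simp add: E_def[abs_def] curve_of_support_def[abs_def])
  then show "curv_locus r (curve_of_support h) =
    (\<lambda>x. (rot90 ^^ r) ((deriv ^^ r) h x *\<^sub>R nvec x + (deriv ^^ Suc r) h x *\<^sub>R tvec x))"
    and "vderiv (curv_locus r (curve_of_support h)) x =
      (rot90 ^^ r) (((deriv ^^ r) h x + (deriv ^^ Suc (Suc r)) h x) *\<^sub>R tvec x)"
    using E' by (simp_all add: E_def[abs_def])
qed

lemma alg_area_curv_locus:
  "alg_area (curv_locus r (curve_of_support (at_angle H))) =
    1 / 2 * ((dif ^^ r) H \<bullet> radius_op ((dif ^^ r) H))"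
proof -
  let ?\<beta> = "curv_locus r (curve_of_support (at_angle H))"
  have "?\<beta> x $ 1 * vderiv ?\<beta> x $ 2 - ?\<beta> x $ 2 * vderiv ?\<beta> x $ 1 =
      at_angle ((dif ^^ r) H) x * at_angle (radius_op ((dif ^^ r) H)) x" for x
  proof -
    let ?a = "at_angle ((dif ^^ r) H) x" and ?b = "at_angle ((dif ^^ Suc r) H) x"
      and ?c = "at_angle (radius_op ((dif ^^ r) H)) x"
    have c: "?c = (deriv ^^ r) (at_angle H) x + (deriv ^^ Suc (Suc r)) (at_angle H) x"
      using at_angle_dif_funpow[of "Suc (Suc r)" H] at_angle_dif_funpow[of r H]
      by (simp add: radius_op_def at_angle_arith)
    have \<beta>: "?\<beta> x = (rot90 ^^ r) (?a *\<^sub>R nvec x + ?b *\<^sub>R tvec x)"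
      and \<beta>': "vderiv ?\<beta> x = (rot90 ^^ r) (?c *\<^sub>R tvec x)"
      unfolding curv_locus_curve_of_support(2)[OF smooth_at_angle] c
      unfolding curv_locus_curve_of_support(1)[OF smooth_at_angle] at_angle_dif_funpow
      by (rule refl)+
    \<comment> \<open>The determinant is an inner product with a rotated vector, and \<open>J\<^sup>r\<close> preserves it.\<close>
    have "?\<beta> x $ 1 * vderiv ?\<beta> x $ 2 - ?\<beta> x $ 2 * vderiv ?\<beta> x $ 1 = rot90 (?\<beta> x) \<bullet> vderiv ?\<beta> x"
      by (simp add: inner_real2)
    also have "\<dots> = rot90 (?a *\<^sub>R nvec x + ?b *\<^sub>R tvec x) \<bullet> (?c *\<^sub>R tvec x)"
      unfolding \<beta> \<beta>' funpow_swap1 by (rule inner_rot90_funpow)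
    also have "\<dots> = ?a * ?c"
      using tvec_inner_tvec[of x] tvec_inner_nvec[of x]
      by (simp add: linear_add[OF linear_rot90] linear_scale[OF linear_rot90] rot90_nvec rot90_tvec
          inner_diff_left inner_diff_right inner_commute)
    finally show ?thesis .
  qed
  then show ?thesis by (simp add: alg_area_def inner_circle_fun_def)
qed

lemma mixed_area_dif:
  assumes "support_fun \<beta> = at_angle g" "support_fun \<delta> = at_angle f"
  shows "mixed_area r \<beta> \<delta> = 1 / 2 * ((dif ^^ r) g \<bullet> radius_op ((dif ^^ r) f))"
proof -
  have "(dif ^^ r) g \<bullet> radius_op ((dif ^^ r) f) = (dif ^^ r) g \<bullet> (dif ^^ r) f - (dif ^^ Suc r) g \<bullet> (dif ^^ Suc r) f"
    by (simp add: inner_radius_op)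
  also have "\<dots> = integral {0..2 * pi} (\<lambda>x. at_angle ((dif ^^ r) g) x * at_angle ((dif ^^ r) f) x -
      at_angle ((dif ^^ Suc r) g) x * at_angle ((dif ^^ Suc r) f) x)"
    unfolding inner_circle_fun_def
    by (rule integral_diff[symmetric]) (rule integrable_at_angle_mult)+
  finally show ?thesis
    by (simp only: mixed_area_def Let_def assms at_angle_dif_funpow)
qed

lemma support_fun_eqI:
  assumes "\<And>b. \<gamma> b \<bullet> nvec a \<le> c" and "\<gamma> a \<bullet> nvec a = c"
  shows "support_fun \<gamma> a = c"
  unfolding support_fun_def
  by (rule cSup_eq_maximum) (use assms in auto)

text \<open>
  The curve built from \<open>f\<close> stays, for every direction \<open>a\<close>, in the half plane of points \<open>x\<close> with
  \<open>x \<bullet> nvec a \<le> f a\<close>. The condition is linear in \<open>f\<close> and invariant under rotation, so that it passes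
  to averages; thus \<open>T\<^sub>k\<close> of a support function is again the support function of its curve.
\<close>

definition is_support :: "circle_fun \<Rightarrow> bool" where
  "is_support f \<longleftrightarrow> (\<forall>a b. at_angle f b * cos (a - b) + at_angle (dif f) b * sin (a - b) \<le> at_angle f a)"

lemma support_fun_curve_of_support:
  assumes "is_support f"
  shows "support_fun (curve_of_support (at_angle f)) = at_angle f"
  by (intro ext support_fun_eqI)
    (use assms in \<open>simp_all add: is_support_def curve_of_support_inner_nvec at_angle_dif\<close>)

lemma is_support_rotate_by:
  assumes "is_support f"
  shows "is_support (rotate_by c f)"
  unfolding is_support_def
proof (intro allI)
  fix a b
  show "at_angle (rotate_by c f) b * cos (a - b) + at_angle (dif (rotate_by c f)) b * sin (a - b)
      \<le> at_angle (rotate_by c f) a"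
    using assms[unfolded is_support_def, rule_format, of "b + c" "a + c"]
    by (simp add: dif_rotate_by at_angle_rotate_by)
qed

lemma is_support_half_avg:
  assumes "is_support f"
  shows "is_support (half_avg k f)"
proof -
  have "is_support (rot_avg k f)"
    unfolding is_support_def
  proof (intro allI)
    fix a b
    let ?r = "\<lambda>j. rotate_by (2 * real j * pi / real k) f"
    have "(\<Sum>j<k. at_angle (?r j) b * cos (a - b) + at_angle (dif (?r j)) b * sin (a - b))
        \<le> (\<Sum>j<k. at_angle (?r j) a)"
      using is_support_rotate_by[OF assms] unfolding is_support_def by (intro sum_mono) blast
    from mult_left_mono[OF this, of "1 / real k"]
    show "at_angle (rot_avg k f) b * cos (a - b) + at_angle (dif (rot_avg k f)) b * sin (a - b)
        \<le> at_angle (rot_avg k f) a"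
      by (simp add: rot_avg_def linear_scale[OF linear_dif] linear_sum[OF linear_dif]
          at_angle_arith at_angle_sum sum.distrib sum_distrib_right add_divide_distrib)
  qed
  then show ?thesis unfolding half_avg_def by (rule is_support_rotate_by)
qed

lemma gen_width_eq_rot_avg: "0 < k \<Longrightarrow> gen_width k (at_angle f) x = real k * at_angle (rot_avg k f) x"
  by (simp add: gen_width_def rot_avg_def at_angle_arith at_angle_sum at_angle_rotate_by)

lemma at_angle_half_avg: "at_angle (half_avg k f) = T_op k (at_angle f)"
proof
  fix x
  have "at_angle f (x + pi / real k + 2 * real j * pi / real k) =
      at_angle f (x + (2 * real (Suc j) - 1) * pi / real k)" for j
    by (rule arg_cong[of _ _ "at_angle f"]) (simp add: add_divide_distrib algebra_simps)
  then show "at_angle (half_avg k f) x = T_op k (at_angle f) x"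
    by (simp add: half_avg_def rot_avg_def T_op_def at_angle_arith at_angle_sum at_angle_rotate_by
        sum.atLeast1_atMost_eq del: of_nat_Suc)
qed

text \<open>
  The width is \<open>k\<close> times the rotational average. It has period \<open>2\<pi>/k\<close>, so that the integral is one
  \<open>k\<close>-th of the integral over the circle.
\<close>

lemma width_square_integral:
  assumes "0 < k" "w = gen_width k (at_angle f)"
  shows "1 / (2 * real k) * integral {0..2 * pi / real k} (\<lambda>x. (w x)\<^sup>2) =
    1 / 2 * (f \<bullet> half_avg k (half_avg k f))"
proof -
  define s where "s = rot_avg k f"
  let ?L = "2 * pi / real k" and ?g = "\<lambda>x. at_angle s x * at_angle s x"
  have per: "at_angle s (x + ?L) = at_angle s x" for x
    using rotate_step_rot_avg[OF assms(1), of f] unfolding s_def by (metis at_angle_rotate_by)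
  have "integral {0..real k * ?L} ?g = real k * integral {0..?L} ?g"
    by (rule integral_over_period(3)) (use per in \<open>auto intro!: continuous_intros continuous_at_angle\<close>)
  then have s: "s \<bullet> s = real k * integral {0..?L} ?g"
    using assms(1) by (simp add: inner_circle_fun_def)
  have "(w x)\<^sup>2 = (real k)\<^sup>2 * ?g x" for x
    by (simp add: assms(2) gen_width_eq_rot_avg[OF assms(1)] s_def power2_eq_square)
  then have "integral {0..?L} (\<lambda>x. (w x)\<^sup>2) = real k * (s \<bullet> s)"
    by (simp add: s power2_eq_square)
  moreover have "s \<bullet> s = f \<bullet> half_avg k (half_avg k f)"
    using self_adjoint_inner[OF self_adjoint_rot_avg[OF assms(1)], of f s]
    by (simp add: s_def rot_avg_idem[OF assms(1)] half_avg_half_avg[OF assms(1)])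
  ultimately show ?thesis using assms(1) by simp
qed

text \<open>
  The product of the width with its translate by half of its period has the period \<open>\<pi>/k\<close>, because the
  translation interchanges the factors.
\<close>

lemma width_product_integral:
  assumes "0 < k" "w = gen_width k (at_angle f)"
  shows "1 / real k * integral {0..pi / real k} (\<lambda>x. w x * w (x + pi / real k)) =
    1 / 2 * (f \<bullet> half_avg k f)"
proof -
  define s where "s = rot_avg k f"
  let ?L = "pi / real k"
  let ?g = "\<lambda>x. at_angle s x * at_angle (half_avg k f) x"
  have t: "at_angle (half_avg k f) x = at_angle s (x + ?L)" for x
    by (simp add: half_avg_def s_def at_angle_rotate_by)
  have per: "at_angle s (x + ?L + ?L) = at_angle s x" for x
  proof -
    have "at_angle s (x + 2 * pi / real k) = at_angle s x"
      using rotate_step_rot_avg[OF assms(1), of f] unfolding s_def by (metis at_angle_rotate_by)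
    moreover have "x + 2 * pi / real k = x + ?L + ?L" by simp
    ultimately show ?thesis by simp
  qed
  have "?g (x + ?L) = ?g x" for x
    unfolding t per by (rule mult.commute)
  then have "integral {0..real (2 * k) * ?L} ?g = real (2 * k) * integral {0..?L} ?g"
    by (intro integral_over_period(3)) (auto intro!: continuous_intros continuous_at_angle)
  then have s: "s \<bullet> half_avg k f = 2 * real k * integral {0..?L} ?g"
    using assms(1) by (simp add: inner_circle_fun_def)
  have "w x * w (x + ?L) = (real k)\<^sup>2 * ?g x" for x
    by (simp add: assms(2) gen_width_eq_rot_avg[OF assms(1)] t power2_eq_square flip: s_def)
  then have "2 * integral {0..?L} (\<lambda>x. w x * w (x + ?L)) = real k * (s \<bullet> half_avg k f)"
    by (simp add: s power2_eq_square)
  moreover have "s \<bullet> half_avg k f = f \<bullet> half_avg k f"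
    using self_adjoint_inner[OF self_adjoint_rot_avg[OF assms(1)], of f "half_avg k f"]
    by (simp add: s_def half_avg_def rot_avg_idem[OF assms(1)] flip: rotate_by_rot_avg)
  ultimately show ?thesis using assms(1) by (simp add: field_simps)
qed

section \<open>Convex curves\<close>

lemma smooth_curve_DERIV:
  assumes "smooth_curve \<gamma>"
  shows "((\<lambda>x. (vderiv ^^ p) \<gamma> x $ i) has_real_derivative (vderiv ^^ Suc p) \<gamma> x $ i) (at x)"
proof -
  have "((vderiv ^^ p) \<gamma> has_vector_derivative (vderiv ^^ Suc p) \<gamma> x) (at x)"
    using assms by (simp add: smooth_curve_def vderiv_def vector_derivative_works)
  from bounded_linear.has_vector_derivative[OF bounded_linear_vec_nth this]
  show ?thesis by (simp add: has_real_derivative_iff_has_vector_derivative)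
qed

lemma smooth_fun_component:
  assumes "smooth_curve \<gamma>"
  shows "smooth_fun (\<lambda>x. \<gamma> x $ i)"
proof (rule smooth_fun_coinduct[where C = "range (\<lambda>p x. (vderiv ^^ p) \<gamma> x $ i)"])
  show "(\<lambda>x. \<gamma> x $ i) \<in> range (\<lambda>p x. (vderiv ^^ p) \<gamma> x $ i)"
    by (rule image_eqI[of _ _ 0]) simp_all
  fix g assume "g \<in> range (\<lambda>p x. (vderiv ^^ p) \<gamma> x $ i)"
  then obtain p where "g = (\<lambda>x. (vderiv ^^ p) \<gamma> x $ i)" by blast
  then show "\<exists>g'\<in>range (\<lambda>p x. (vderiv ^^ p) \<gamma> x $ i). \<forall>x. (g has_real_derivative g' x) (at x)"
    using smooth_curve_DERIV[OF assms, of p i]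
    by (intro bexI[of _ "\<lambda>x. (vderiv ^^ Suc p) \<gamma> x $ i"]) blast+
qed

text \<open>
  The outward normal at \<open>\<gamma> a\<close> is \<open>nvec a\<close>, so the supremum in the definition of the support function is
  attained at \<open>\<gamma> a\<close>, and \<open>b \<mapsto> \<gamma> b \<bullet> nvec a\<close> has a maximum at \<open>b = a\<close>. Hence \<open>\<gamma>'\<close> is orthogonal to the normal,
  \<open>h' = \<gamma> \<bullet> tvec\<close>, and \<open>\<gamma>\<close> is recovered from its coordinates \<open>h\<close> and \<open>h'\<close> in the moving frame.
\<close>

lemma convex_curve_support:
  assumes "smooth_convex_curve \<gamma>"
  obtains H where "support_fun \<gamma> = at_angle H" "\<gamma> = curve_of_support (at_angle H)" "is_support H"
proof -
  have smooth: "smooth_curve \<gamma>" and per: "\<And>x. \<gamma> (x + 2 * pi) = \<gamma> x"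
    and out: "\<And>a b. \<gamma> b \<bullet> nvec a \<le> \<gamma> a \<bullet> nvec a"
    using assms unfolding smooth_convex_curve_def
    by (auto simp: inner_diff_left hull_inc)
  define h where "h x = \<gamma> x $ 1 * cos x + \<gamma> x $ 2 * sin x" for x
  have h: "h x = \<gamma> x \<bullet> nvec x" for x by (simp add: h_def inner_real2)
  have support: "support_fun \<gamma> = h"
    by (intro ext support_fun_eqI) (simp_all add: h out)
  have D: "((\<lambda>x. \<gamma> x $ i) has_real_derivative vderiv \<gamma> x $ i) (at x)" for i x
    using smooth_curve_DERIV[OF smooth, of 0] by simp
  have orth: "vderiv \<gamma> a \<bullet> nvec a = 0" for a
  proof -
    have "((\<lambda>b. \<gamma> b \<bullet> nvec a) has_real_derivative vderiv \<gamma> a \<bullet> nvec a) (at a)"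
      unfolding inner_real2 by (intro DERIV_add DERIV_cmult_right D)
    then show ?thesis by (rule DERIV_local_max[of _ _ _ 1]) (use out in auto)
  qed
  have h': "(h has_real_derivative \<gamma> x \<bullet> tvec x) (at x)" for x
  proof -
    have "(h has_real_derivative vderiv \<gamma> x \<bullet> nvec x + \<gamma> x \<bullet> tvec x) (at x)"
      unfolding h_def[abs_def]
      by (auto intro!: derivative_eq_intros D simp: inner_real2 algebra_simps)
    then show ?thesis by (simp add: orth)
  qed
  define H where "H = Abs_circle_fun h"
  have H: "at_angle H = h"
    unfolding H_def
  proof (rule at_angle_Abs)
    show "smooth_fun h"
      unfolding h_def[abs_def] by (intro smooth_fun_trig smooth_fun_component smooth)
  qed (simp add: h_def per)
  have curve: "\<gamma> = curve_of_support h"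
  proof
    fix x
    have "x $ 1 = (x \<bullet> nvec a) * cos a - (x \<bullet> tvec a) * sin a"
      "x $ 2 = (x \<bullet> nvec a) * sin a + (x \<bullet> tvec a) * cos a" for x a
    proof -
      have pythagoras: "cos a * (cos a * y) + sin a * (sin a * y) = y" for y
        by (metis distrib_right mult.assoc mult_1 sin_cos_squared_add3)
      show "x $ 1 = (x \<bullet> nvec a) * cos a - (x \<bullet> tvec a) * sin a"
        "x $ 2 = (x \<bullet> nvec a) * sin a + (x \<bullet> tvec a) * cos a"
        unfolding inner_real2 nvec_nth tvec_nth by (simp_all add: algebra_simps pythagoras)
    qed
    note coords = this
    show "\<gamma> x = curve_of_support h x"
      using coords[of "\<gamma> x" x]
      by (intro vec2_eqI) (simp_all add: curve_of_support_def h DERIV_imp_deriv[OF h'])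
  qed
  have "h b * cos (a - b) + deriv h b * sin (a - b) \<le> h a" for a b
    using out[of b a] unfolding h[symmetric] curve_of_support_inner_nvec[symmetric] curve[symmetric] .
  then have "is_support H"
    by (simp add: is_support_def H at_angle_dif)
  with support curve show thesis by (intro that[of H]) (simp_all only: H)
qed

lemma range_circle: "r \<noteq> 0 \<Longrightarrow> range (\<lambda>x. p + r *\<^sub>R nvec x) = sphere p \<bar>r\<bar>"
proof (intro equalityI subsetI)
  fix y assume "r \<noteq> 0" "y \<in> sphere p \<bar>r\<bar>"
  define z where "z = (1 / r) *\<^sub>R (y - p)"
  have "norm z = 1"
    using \<open>r \<noteq> 0\<close> \<open>y \<in> sphere p \<bar>r\<bar>\<close> by (simp add: z_def dist_norm norm_minus_commute)
  then have "(z $ 1)\<^sup>2 + (z $ 2)\<^sup>2 = 1"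
    using dot_square_norm[of z] by (simp add: inner_real2 power2_eq_square)
  then obtain a where "z $ 1 = cos a" "z $ 2 = sin a" by (rule sincos_total_2pi)
  then have "z = nvec a" by (intro vec2_eqI) simp_all
  moreover have "y = p + r *\<^sub>R z" using \<open>r \<noteq> 0\<close> by (simp add: z_def)
  ultimately show "y \<in> range (\<lambda>x. p + r *\<^sub>R nvec x)" by blast
next
  fix y assume "y \<in> range (\<lambda>x. p + r *\<^sub>R nvec x)"
  moreover have "norm (nvec x) = 1" for x by (simp add: norm_eq_sqrt_inner nvec_inner_nvec)
  ultimately show "y \<in> sphere p \<bar>r\<bar>" by (auto simp: dist_norm)
qed

text \<open>
  If the radius of curvature is a constant \<open>c\<close>, then \<open>\<gamma>' = c tvec = (c nvec)'\<close>, so that \<open>\<gamma> - c nvec\<close>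
  is a fixed centre; regularity of \<open>\<gamma>\<close> gives \<open>c \<noteq> 0\<close>. Conversely, a circle of radius \<open>r\<close> with centre \<open>p\<close> has
  the support function \<open>r + p \<bullet> nvec\<close>.
\<close>

lemma is_circle_iff:
  assumes convex: "smooth_convex_curve \<gamma>" and H: "support_fun \<gamma> = at_angle H"
    and curve: "\<gamma> = curve_of_support (at_angle H)"
  shows "is_circle \<gamma> \<longleftrightarrow> (\<exists>c. radius_op H = c *\<^sub>R const_one)"
proof
  assume "\<exists>c. radius_op H = c *\<^sub>R const_one"
  then obtain c where "radius_op H = c *\<^sub>R const_one" by blast
  then have c: "at_angle H x + at_angle (dif (dif H)) x = c" for x
    using at_angle_arith(2)[of H "dif (dif H)" x] by (simp add: radius_op_def at_angle_arith at_angle_const_one)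
  have D: "(\<gamma> has_vector_derivative c *\<^sub>R tvec x) (at x)" for x
    using frame_derivative[OF DERIV_at_angle[of H] DERIV_at_angle[of "dif H"], of 0 x]
    by (simp add: curve curve_of_support_def[abs_def] c flip: at_angle_dif)
  have "((\<lambda>x. \<gamma> x - c *\<^sub>R nvec x) has_vector_derivative c *\<^sub>R tvec x - (c *\<^sub>R tvec x + 0 *\<^sub>R nvec x)) (at x)" for x
    by (intro has_vector_derivative_diff D has_vector_derivative_scaleR nvec_derivative) simp
  then have "((\<lambda>x. \<gamma> x - c *\<^sub>R nvec x) has_vector_derivative 0) (at x within UNIV)" for x by simp
  from has_vector_derivative_zero_constant[OF convex_UNIV this]
  obtain p where "\<And>x. \<gamma> x - c *\<^sub>R nvec x = p" by auto
  then have \<gamma>: "\<gamma> = (\<lambda>x. p + c *\<^sub>R nvec x)" by (auto simp: algebra_simps fun_eq_iff)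
  have "vderiv \<gamma> 0 = c *\<^sub>R tvec 0" unfolding vderiv_def by (rule vector_derivative_at[OF D])
  then have "c \<noteq> 0" using convex by (auto simp: smooth_convex_curve_def)
  then show "is_circle \<gamma>"
    unfolding is_circle_def using range_circle[of c p] \<gamma> by (intro exI[of _ p] exI[of _ "\<bar>c\<bar>"]) simp
next
  assume "is_circle \<gamma>"
  then obtain p r where "r > 0" and r: "range \<gamma> = sphere p r" by (auto simp: is_circle_def)
  have h: "at_angle H x = r + (p $ 1 * cos x + p $ 2 * sin x)" for x
  proof -
    have norm_n: "norm (nvec x) = 1" by (simp add: norm_eq_sqrt_inner nvec_inner_nvec)
    have "support_fun \<gamma> x = r + p \<bullet> nvec x"
      unfolding support_fun_def r
    proof (rule cSup_eq_maximum)
      have "p + r *\<^sub>R nvec x \<in> sphere p r" using \<open>r > 0\<close> norm_n by (simp add: dist_norm)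
      moreover have "r + p \<bullet> nvec x = (p + r *\<^sub>R nvec x) \<bullet> nvec x"
        by (simp add: inner_add_left nvec_inner_nvec)
      ultimately show "r + p \<bullet> nvec x \<in> (\<lambda>y. y \<bullet> nvec x) ` sphere p r" by blast
      fix s assume "s \<in> (\<lambda>y. y \<bullet> nvec x) ` sphere p r"
      then obtain y where y: "y \<in> sphere p r" "s = y \<bullet> nvec x" by blast
      have "(y - p) \<bullet> nvec x \<le> norm (y - p) * norm (nvec x)" by (rule norm_cauchy_schwarz)
      then show "s \<le> r + p \<bullet> nvec x"
        using y norm_n by (simp add: inner_diff_left dist_norm norm_minus_commute)
    qed
    then show ?thesis by (simp add: H inner_real2)
  qed
  have h': "at_angle (dif H) x = p $ 2 * cos x - p $ 1 * sin x" for x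
  proof (rule DERIV_unique[OF DERIV_at_angle])
    have "at_angle H = (\<lambda>x. r + (p $ 1 * cos x + p $ 2 * sin x))" by (rule ext) (rule h)
    then show "(at_angle H has_real_derivative p $ 2 * cos x - p $ 1 * sin x) (at x)"
      by (auto intro!: derivative_eq_intros)
  qed
  have h'': "at_angle (dif (dif H)) x = - (p $ 1 * cos x + p $ 2 * sin x)" for x
  proof (rule DERIV_unique[OF DERIV_at_angle])
    have "at_angle (dif H) = (\<lambda>x. p $ 2 * cos x - p $ 1 * sin x)" by (rule ext) (rule h')
    then show "(at_angle (dif H) has_real_derivative - (p $ 1 * cos x + p $ 2 * sin x)) (at x)"
      by (auto intro!: derivative_eq_intros)
  qed
  have "radius_op H = r *\<^sub>R const_one"
    by (rule circle_fun_eqI) (simp add: radius_op_def at_angle_arith h h'' at_angle_const_one)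
  then show "\<exists>c. radius_op H = c *\<^sub>R const_one" by blast
qed

section \<open>The inequality for the higher curvature loci\<close>

theorem theorem6:
  fixes k m :: nat and \<gamma> :: "real \<Rightarrow> real^2" and h w :: "real \<Rightarrow> real"
    and T\<gamma> TT\<gamma> :: "real \<Rightarrow> real^2"
  assumes "k \<ge> 2" and "m \<ge> 1"
    and "smooth_convex_curve \<gamma>"
    and "h = support_fun \<gamma>"
    and "w = gen_width k h"
    and "T\<gamma> = curve_of_support (T_op k h)"
    and "TT\<gamma> = curve_of_support (T_op k (T_op k h))"
  shows "(odd m \<longrightarrow>
      (let D =
          - (\<Sum>r=0..m-1. (-1)^r * real ((m-1) choose r) * alg_area (curv_locus r \<gamma>))
          + 1 / real k * integral {0..pi / real k} (\<lambda>\<theta>. w \<theta> * w (\<theta> + pi / real k))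
          - (\<Sum>j\<in>{j. 1 \<le> j \<and> j \<le> m-1 \<and> even j}. real (m choose j) *
               (\<Sum>r=0..m-1. (-1)^r * real ((m-1-j) choose r) * mixed_area r \<gamma> TT\<gamma>))
          + (\<Sum>j\<in>{j. 1 \<le> j \<and> j \<le> m-1 \<and> odd j}. real (m choose j) *
               (\<Sum>r=0..m-1. (-1)^r * real ((m-1-j) choose r) * mixed_area r \<gamma> T\<gamma>))
       in 0 \<le> D \<and> (D = 0 \<longleftrightarrow> is_circle \<gamma>)))
    \<and> (even m \<longrightarrow>
      (let D =
          (\<Sum>r=0..m-1. (-1)^r * real ((m-1) choose r) * alg_area (curv_locus r \<gamma>))
          + 1 / (2 * real k) * integral {0..2 * pi / real k} (\<lambda>\<theta>. (w \<theta>)^2)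
          + (\<Sum>j\<in>{j. 1 \<le> j \<and> j \<le> m-1 \<and> even j}. real (m choose j) *
               (\<Sum>r=0..m-1. (-1)^r * real ((m-1-j) choose r) * mixed_area r \<gamma> TT\<gamma>))
          - (\<Sum>j\<in>{j. 1 \<le> j \<and> j \<le> m-1 \<and> odd j}. real (m choose j) *
               (\<Sum>r=0..m-1. (-1)^r * real ((m-1-j) choose r) * mixed_area r \<gamma> T\<gamma>))
       in 0 \<le> D \<and> (D = 0 \<longleftrightarrow> is_circle \<gamma>)))"
proof -
  have k: "0 < k" using assms(1) by simp
  obtain H where H: "support_fun \<gamma> = at_angle H" and curve: "\<gamma> = curve_of_support (at_angle H)"
    and "is_support H" using convex_curve_support[OF assms(3)] by blast
  let ?T = "half_avg k"
  have h: "h = at_angle H" using assms(4) H by simp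
  have T: "support_fun T\<gamma> = at_angle (?T H)"
    using support_fun_curve_of_support[OF is_support_half_avg[OF \<open>is_support H\<close>, of k]]
    by (simp add: assms(6) h at_angle_half_avg)
  have TT: "support_fun TT\<gamma> = at_angle (?T (?T H))"
    using support_fun_curve_of_support[OF is_support_half_avg[OF is_support_half_avg[OF \<open>is_support H\<close>, of k], of k]]
    by (simp add: assms(7) h at_angle_half_avg)
  have w: "w = gen_width k (at_angle H)" using assms(5) h by simp

  have area: "(\<Sum>r=0..m-1. (-1)^r * real ((m-1) choose r) * alg_area (curv_locus r \<gamma>)) =
      1 / 2 * (H \<bullet> (radius_op ^^ m) H)"
  proof -
    have "(\<Sum>r=0..m-1. (-1)^r * real ((m-1) choose r) * alg_area (curv_locus r \<gamma>)) =
        1 / 2 * (\<Sum>r=0..m-1. (-1)^r * real ((m-1) choose r) * ((dif ^^ r) H \<bullet> radius_op ((dif ^^ r) H)))"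
      by (simp add: curve alg_area_curv_locus sum_divide_distrib)
    also have "\<dots> = 1 / 2 * (H \<bullet> (radius_op ^^ Suc (m-1)) H)"
      by (simp only: sum_inner_dif_radius_op[OF order_refl])
    finally show ?thesis using assms(2) by simp
  qed
  have mixed: "(\<Sum>r=0..m-1. (-1)^r * real ((m-1-j) choose r) * mixed_area r \<gamma> \<delta>) =
      1 / 2 * (H \<bullet> (radius_op ^^ (m - j)) G)"
    if "j \<le> m - 1" "support_fun \<delta> = at_angle G" for j \<delta> G
  proof -
    have "(\<Sum>r=0..m-1. (-1)^r * real ((m-1-j) choose r) * mixed_area r \<gamma> \<delta>) =
        1 / 2 * (\<Sum>r=0..m-1. (-1)^r * real ((m-1-j) choose r) * ((dif ^^ r) H \<bullet> radius_op ((dif ^^ r) G)))"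
      by (simp add: mixed_area_dif[OF H that(2)] sum_divide_distrib)
    also have "\<dots> = 1 / 2 * (H \<bullet> (radius_op ^^ Suc (m-1-j)) G)"
      by (subst sum_inner_dif_radius_op) auto
    also have "Suc (m-1-j) = m - j" using that(1) assms(2) by simp
    finally show ?thesis .
  qed
  have mixed_sum: "(\<Sum>j\<in>{j. 1 \<le> j \<and> j \<le> m-1 \<and> P j}. real (m choose j) *
        (\<Sum>r=0..m-1. (-1)^r * real ((m-1-j) choose r) * mixed_area r \<gamma> \<delta>)) =
      1 / 2 * (\<Sum>j\<in>{j. 1 \<le> j \<and> j \<le> m-1 \<and> P j}. real (m choose j) * (H \<bullet> (radius_op ^^ (m - j)) G))"
    if "support_fun \<delta> = at_angle G" for P \<delta> G
  proof -
    have "real (m choose j) * (\<Sum>r=0..m-1. (-1)^r * real ((m-1-j) choose r) * mixed_area r \<gamma> \<delta>) =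
        1 / 2 * (real (m choose j) * (H \<bullet> (radius_op ^^ (m - j)) G))"
      if "j \<in> {j. 1 \<le> j \<and> j \<le> m-1 \<and> P j}" for j
    proof -
      have "j \<le> m - 1" using that by simp
      from mixed[OF this \<open>support_fun \<delta> = at_angle G\<close>] show ?thesis
        by (simp only: mult.left_commute)
    qed
    from sum.cong[OF refl this] show ?thesis
      by (simp only: sum_distrib_left[of "1 / 2"])
  qed

  \<comment> \<open>Up to the factor \<open>(-1)\<^sup>m / 2\<close>, both right-hand sides are this quadratic form.\<close>
  define Q where "Q = H \<bullet> (gap_op k ^^ m) H"
  note expansion = gap_op_power_expansion[OF k assms(2), of H, folded Q_def]
  have sign: "0 \<le> (-1) ^ m * Q"
    unfolding Q_def by (rule nonpos_funpow_form[OF self_adjoint_gap_op[OF k] gap_op_nonpos[OF assms(1)]])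
  have circle: "Q = 0 \<longleftrightarrow> is_circle \<gamma>"
  proof -
    have "Q = 0 \<longleftrightarrow> gap_op k H = 0"
    proof
      assume "Q = 0"
      then show "gap_op k H = 0"
        using nonpos_funpow_form(2)[OF self_adjoint_gap_op[OF k] gap_op_nonpos[OF assms(1)], of m H] assms(2)
        by (simp add: Q_def)
    next
      assume 0: "gap_op k H = 0"
      obtain p where "m = Suc p" using assms(2) by (cases m) auto
      then have "Q = H \<bullet> (gap_op k ^^ p) (gap_op k H)" by (simp only: Q_def funpow_Suc_right o_apply)
      then show "Q = 0"
        by (simp add: 0 linear_0[OF linear_funpow[OF self_adjoint_linear[OF self_adjoint_gap_op[OF k]]]])
    qed
    then show ?thesis
      by (simp only: gap_op_kernel[OF assms(1)] is_circle_iff[OF assms(3) H curve])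
  qed
  show ?thesis
    unfolding Let_def area mixed_sum[OF T] mixed_sum[OF TT]
      width_square_integral[OF k w] width_product_integral[OF k w]
  proof (rule conjI; rule impI)
    assume 1: "odd m"
    let ?D = "- (1 / 2 * (H \<bullet> (radius_op ^^ m) H)) + 1 / 2 * (H \<bullet> ?T H)
      - 1 / 2 * (\<Sum>j\<in>{j. 1 \<le> j \<and> j \<le> m-1 \<and> even j}. real (m choose j) * (H \<bullet> (radius_op ^^ (m - j)) (?T (?T H))))
      + 1 / 2 * (\<Sum>j\<in>{j. 1 \<le> j \<and> j \<le> m-1 \<and> odd j}. real (m choose j) * (H \<bullet> (radius_op ^^ (m - j)) (?T H)))"
    have D: "?D = - Q / 2" using expansion 1 by simp
    show "0 \<le> ?D \<and> (?D = 0 \<longleftrightarrow> is_circle \<gamma>)"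
      unfolding D using sign circle 1 by simp
  next
    assume 2: "even m"
    let ?D = "1 / 2 * (H \<bullet> (radius_op ^^ m) H) + 1 / 2 * (H \<bullet> ?T (?T H))
      + 1 / 2 * (\<Sum>j\<in>{j. 1 \<le> j \<and> j \<le> m-1 \<and> even j}. real (m choose j) * (H \<bullet> (radius_op ^^ (m - j)) (?T (?T H))))
      - 1 / 2 * (\<Sum>j\<in>{j. 1 \<le> j \<and> j \<le> m-1 \<and> odd j}. real (m choose j) * (H \<bullet> (radius_op ^^ (m - j)) (?T H)))"
    have D: "?D = Q / 2" using expansion 2 by simp
    show "0 \<le> ?D \<and> (?D = 0 \<longleftrightarrow> is_circle \<gamma>)"
      unfolding D using sign circle 2 by simp
  qed
qed

end
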